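(* There is a universal constant $C$ such that for every $n\ge1$ and every Boolean function $f:\{-1,1\}^n\to\{-1,1\}$, $$\mathsf T_{\rm frac}(f)\ \le\ C\,\mathsf B(f)\log(en).$$
   Context: $\{-1,1\}^n$ carries the uniform probability measure. $x^{\oplus i}$ is $x$ with the $i$th coordinate flipped. $D_ig(x)=\frac{g(x)-g(x^{\oplus i})}2$, $L=\sum_{i=1}^n D_i$. A vector field is a map $V=(V_1,\dots,V_n):\{-1,1\}^n\to\mathbb R^n$, with $\operatorname{div}V(x)=\sum_{i=1}^n(V_i(x)-V_i(x^{\oplus i}))$. The Beckmann boundary is $\mathsf B(f)=\inf\{\mathbb E\|V(x)\|_2:\operatorname{div}V=Lf\}$ ($\|\cdot\|_2$ Euclidean norm). Let $E_f$ be the set of sensitive edges of $f$, i.e. edges $\{x,x^{\oplus i}\}$ of the cube with $f(x)\ne f(x^{\oplus i})$. For a fractional coloring $\theta:E_f\to[0,1]$ let $$\mathsf T_\theta(f)=\mathbb E_x\Big(\sum_{i:\,f(x)=1,\,f(x^{\oplus i})=-1}\theta_{\{x,x^{\oplus i}\}}^2+\sum_{i:\,f(x)=-1,\,f(x^{\oplus i})=1}(1-\theta_{\{x,x^{\oplus i}\}})^2\Big)^{1/2},$$ and $\mathsf T_{\rm frac}(f)=\inf_\theta\mathsf T_\theta(f)$. *)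

theory Defs
  imports "HOL-Probability.Probability"
begin

text \<open>
  The dimension n is quantified inside the main statement, so points of the cube are extensional
  functions on \<open>{1..n}\<close>, and functions on the cube are only ever inspected on \<^term>\<open>cube n\<close>.
\<close>

definition cube :: "nat \<Rightarrow> (nat \<Rightarrow> real) set" where
  "cube n = {1..n} \<rightarrow>\<^sub>E {-1, 1}"

definition expect :: "nat \<Rightarrow> ((nat \<Rightarrow> real) \<Rightarrow> real) \<Rightarrow> real" where
  "expect n g = measure_pmf.expectation (pmf_of_set (cube n)) g"

definition flip :: "nat \<Rightarrow> (nat \<Rightarrow> real) \<Rightarrow> (nat \<Rightarrow> real)" where
  "flip i x = x(i := - x i)"

definition deriv_coord :: "nat \<Rightarrow> ((nat \<Rightarrow> real) \<Rightarrow> real) \<Rightarrow> (nat \<Rightarrow> real) \<Rightarrow> real" where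
  "deriv_coord i g x = (g x - g (flip i x)) / 2"

definition laplacian :: "nat \<Rightarrow> ((nat \<Rightarrow> real) \<Rightarrow> real) \<Rightarrow> (nat \<Rightarrow> real) \<Rightarrow> real" where
  "laplacian n g x = (\<Sum>i\<in>{1..n}. deriv_coord i g x)"

text \<open>A vector field is a curried function: \<open>V x i\<close> is the \<open>i\<close>-th component at the point \<open>x\<close>.\<close>

definition divergence :: "nat \<Rightarrow> ((nat \<Rightarrow> real) \<Rightarrow> nat \<Rightarrow> real) \<Rightarrow> (nat \<Rightarrow> real) \<Rightarrow> real" where
  "divergence n V x = (\<Sum>i\<in>{1..n}. V x i - V (flip i x) i)"

definition beckmann_fields ::
    "nat \<Rightarrow> ((nat \<Rightarrow> real) \<Rightarrow> real) \<Rightarrow> ((nat \<Rightarrow> real) \<Rightarrow> nat \<Rightarrow> real) set" where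
  "beckmann_fields n f = {V. \<forall>x\<in>cube n. divergence n V x = laplacian n f x}"

definition beckmann :: "nat \<Rightarrow> ((nat \<Rightarrow> real) \<Rightarrow> real) \<Rightarrow> real" where
  "beckmann n f = (INF V\<in>beckmann_fields n f. expect n (\<lambda>x. L2_set (V x) {1..n}))"

definition sensitive_edges :: "nat \<Rightarrow> ((nat \<Rightarrow> real) \<Rightarrow> real) \<Rightarrow> (nat \<Rightarrow> real) set set" where
  "sensitive_edges n f =
     {{x, flip i x} | x i. x \<in> cube n \<and> i \<in> {1..n} \<and> f x \<noteq> f (flip i x)}"

definition talagrand_coloring ::
    "nat \<Rightarrow> ((nat \<Rightarrow> real) \<Rightarrow> real) \<Rightarrow> ((nat \<Rightarrow> real) set \<Rightarrow> real) \<Rightarrow> real" where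
  "talagrand_coloring n f \<theta> = expect n (\<lambda>x. sqrt (
      (\<Sum>i | i \<in> {1..n} \<and> f x = 1 \<and> f (flip i x) = -1. (\<theta> {x, flip i x})\<^sup>2)
    + (\<Sum>i | i \<in> {1..n} \<and> f x = -1 \<and> f (flip i x) = 1. (1 - \<theta> {x, flip i x})\<^sup>2)))"

definition talagrand_frac :: "nat \<Rightarrow> ((nat \<Rightarrow> real) \<Rightarrow> real) \<Rightarrow> real" where
  "talagrand_frac n f = (INF \<theta>\<in>sensitive_edges n f \<rightarrow> {0..1}. talagrand_coloring n f \<theta>)"

text \<open>
  Both infima are taken over nonempty families of nonnegative reals, so the real-valued
  \<^const>\<open>Inf\<close> is the usual infimum.
\<close>

lemma flip_flip [simp]: "flip i (flip i x) = x"
  by (simp add: flip_def)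

lemma expect_nonneg: "(\<And>x. 0 \<le> g x) \<Longrightarrow> 0 \<le> expect n g"
  unfolding expect_def by (rule Bochner_Integration.integral_nonneg)

lemma beckmann_fields_nonempty: "beckmann_fields n f \<noteq> {}"
proof -
  have "(\<lambda>x i. deriv_coord i f x / 2) \<in> beckmann_fields n f"
    by (auto simp: beckmann_fields_def divergence_def laplacian_def deriv_coord_def field_simps
        intro!: sum.cong)
  then show ?thesis by blast
qed

lemma beckmann_bdd_below:
  "bdd_below ((\<lambda>V. expect n (\<lambda>x. L2_set (V x) {1..n})) ` beckmann_fields n f)"
  by (rule bdd_belowI[of _ 0]) (auto intro: expect_nonneg)

lemma talagrand_bdd_below:
  "bdd_below (talagrand_coloring n f ` (sensitive_edges n f \<rightarrow> {0..1}))"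
  by (rule bdd_belowI[of _ 0])
    (auto simp: talagrand_coloring_def intro!: expect_nonneg add_nonneg_nonneg sum_nonneg)

lemma colorings_nonempty: "sensitive_edges n f \<rightarrow> {0..1::real} \<noteq> {}"
  by (auto simp: Pi_eq_empty)

end

theory Submission
  imports Defs
begin

text \<open>
  Both sides measure vector fields in \<open>L\<^sup>1\<close>. A fractional coloring splits the jump of \<open>f\<close> across every
  sensitive edge between its two ends, so it is a field whose antisymmetric part is prescribed edge by
  edge, while a Beckmann field only has the right divergence. Passing from the second to the first
  is a Riesz-transform type problem near the endpoint \<open>L\<^sup>1\<close>, where a logarithm is lost.

  Duality. A coloring that minimises a slightly smoothed cost is balanced: on each sensitive edge,
  the share of an end divided by the total length of the shares there is the same for both ends
  (\<open>minimiser_balanced\<close>). These ratios, with the sign of \<open>f\<close>, form a field \<open>h\<close> that is antisymmetric across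
  edges, has length at most \<open>1\<close>, is aligned with the gradient of \<open>f\<close>, and whose total \<open>\<Theta> = (\<Sum>x. \<Sum>i. |h i x|)\<close> dominates
  the cost. It remains to show \<open>\<Theta> \<le> C (1 + ln n) (\<Sum>x. |V x|)\<close> whenever \<open>div V = L f\<close> (\<open>duality_bound\<close>).

  Flow. Let \<open>Q\<close> be the lazy random walk on the cube; it commutes with all differences \<open>D i\<close>. As
  \<open>\<Theta> = \<langle>f, H\<rangle>\<close> with \<open>H = (\<Sum>j. h j)\<close>, it is a sum over time of \<open>\<langle>L f, H + Q H\<rangle> / n\<close>, evaluated along the flow
  (\<open>duhamel\<close>). The tail after \<open>2 n\<close> steps is at most \<open>\<Theta> / 4\<close>, because \<open>Q\<close> contracts functions antisymmetric
  in a coordinate by \<open>1 - 1 / n\<close> in \<open>L\<^sup>1\<close> (\<open>antisym_Q_L1\<close>). Inserting \<open>L f = div V\<close> and integrating by parts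
  twice turns the pairing into the sum of the products of \<open>D j (V i)\<close> and \<open>D i (h j)\<close> (\<open>flux_by_parts\<close>).

  Energies. Let \<open>u\<close> start as \<open>|V| + 1\<close> and follow the flow, so that it keeps dominating \<open>|V|\<close>. Convexity of
  \<open>|V|\<^sup>2 / u\<close> and of \<open>u ln u\<close> shows that the sum over all times of \<open>|D j V|\<^sup>2 / max (u x) (u (flip j x))\<close>, over the edges where \<open>u\<close> is below a cap, is at most
  a multiple of the \<open>L\<^sup>1\<close> norm of \<open>V\<close> times the logarithm of the cap (\<open>total_edge_energy\<close>).
  The complementary energy, of \<open>u |D h|\<^sup>2\<close> with \<open>u\<close> capped, is bounded by the same quantity plus a multiple of \<open>\<Theta>\<close>
  (\<open>total_weighted_grad\<close>). Differences of \<open>V\<close> are weighed by the larger end of an edge \<open>j\<close>, those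
  of \<open>h\<close> by a single point; antisymmetry of \<open>h j\<close> lets the weight cross the edge, so Cauchy-Schwarz combines
  both with a single logarithm.

  Truncation. The cap must be polynomial in \<open>n\<close>, although \<open>V\<close> may be concentrated. Here it matters that \<open>f\<close>
  is bounded: where \<open>u\<close> exceeds \<open>16 n\<^sup>2\<close> the trivial bound \<open>|L f| \<le> n\<close> suffices, since that set has at most
  of the order of \<open>(1 / n\<^sup>2) (\<Sum>x. |V x|)\<close> points (\<open>bad_set_flux\<close>). The transition is made by a cutoff that is symmetric on
  each edge, and the increments of the cutoff are paid by the dissipated entropy of \<open>u\<close>
  (\<open>cutoff_gradient_total\<close>). Evaluating it one step later than \<open>u\<close> guarantees that \<open>u\<close> is below \<open>64 n\<^sup>3\<close> wherever
  it is used (\<open>localised\<close>).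
\<close>

section \<open>The lazy walk generated by commuting involutions\<close>

text \<open>The cube enters only through the coordinate flips, so the analytic part is carried out for any
  finite set closed under finitely many commuting involutions. They are taken to be involutions of the whole
  type, which makes the commutation rules below equations between functions, without membership
  side conditions.\<close>

locale involution_walk =
  fixes X :: "'a set" and I :: "'i set" and \<sigma> :: "'i \<Rightarrow> 'a \<Rightarrow> 'a"
  assumes finX: "finite X" and finI: "finite I" and neI: "I \<noteq> {}"
    and invol [simp]: "\<sigma> i (\<sigma> i x) = x"
    and comm: "\<sigma> i (\<sigma> j x) = \<sigma> j (\<sigma> i x)"
    and closed: "i \<in> I \<Longrightarrow> x \<in> X \<Longrightarrow> \<sigma> i x \<in> X"
begin

definition N :: real where "N = real (card I)"

definition D :: "'i \<Rightarrow> ('a \<Rightarrow> real) \<Rightarrow> 'a \<Rightarrow> real" where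
  "D i g x = (g x - g (\<sigma> i x)) / 2"

definition Lap :: "('a \<Rightarrow> real) \<Rightarrow> 'a \<Rightarrow> real" where
  "Lap g x = (\<Sum>i\<in>I. D i g x)"

text \<open>One step of the lazy random walk. It plays the role of the heat semigroup at time \<open>1 / N\<close>: by
  \<open>Q_Lap\<close> below it is the identity minus \<open>Lap / N\<close>, and laziness gives \<open>Q u \<ge> u / 2\<close>,
  which lets quantities at consecutive times be compared.\<close>

definition Q :: "('a \<Rightarrow> real) \<Rightarrow> 'a \<Rightarrow> real" where
  "Q g x = (g x + (\<Sum>i\<in>I. g (\<sigma> i x)) / N) / 2"

definition antisym_along :: "'i \<Rightarrow> ('a \<Rightarrow> real) \<Rightarrow> bool" where
  "antisym_along i g \<longleftrightarrow> (\<forall>x. g (\<sigma> i x) = - g x)"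

lemma N_ge_1: "1 \<le> N"
  using finI neI card_gt_0_iff[of I] by (simp add: N_def)

lemma N_pos: "0 < N"
  using N_ge_1 by simp

lemma card_N [simp]: "real (card I) = N"
  by (simp add: N_def)

lemma sum_const_I: "(\<Sum>i\<in>I. c) = N * (c::real)"
  by simp

lemma sum_flip: "i \<in> I \<Longrightarrow> (\<Sum>x\<in>X. g (\<sigma> i x)) = (\<Sum>x\<in>X. g x)"
  by (rule sum.reindex_bij_witness[where i="\<sigma> i" and j="\<sigma> i"]) (auto simp: closed)

text \<open>The flip may depend on the summation index. This is how a weight is moved from one end of an edge
  to the other.\<close>

lemma sum_flip_family:
  "(\<Sum>x\<in>X. \<Sum>i\<in>I. g i (\<sigma> i x)) = (\<Sum>x\<in>X. \<Sum>i\<in>I. g i x :: real)"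
proof -
  have "(\<Sum>x\<in>X. \<Sum>i\<in>I. g i (\<sigma> i x)) = (\<Sum>i\<in>I. \<Sum>x\<in>X. g i (\<sigma> i x))"
    by (rule sum.swap)
  also have "\<dots> = (\<Sum>i\<in>I. \<Sum>x\<in>X. g i x)"
    by (intro sum.cong refl sum_flip)
  finally show ?thesis
    by (simp add: sum.swap[of _ I X])
qed

lemma sum_sym_weight:
  assumes "\<And>i x. i \<in> I \<Longrightarrow> g i (\<sigma> i x) = g i x"
  shows "(\<Sum>x\<in>X. \<Sum>i\<in>I. (u x + u (\<sigma> i x)) * g i x) = 2 * (\<Sum>x\<in>X. u x * (\<Sum>i\<in>I. g i x :: real))"
proof -
  have "(\<Sum>x\<in>X. \<Sum>i\<in>I. u (\<sigma> i x) * g i x) = (\<Sum>x\<in>X. \<Sum>i\<in>I. u (\<sigma> i x) * g i (\<sigma> i x))"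
    using assms by (intro sum.cong refl) simp
  also have "\<dots> = (\<Sum>x\<in>X. \<Sum>i\<in>I. u x * g i x)"
    by (rule sum_flip_family[where g="\<lambda>i x. u x * g i x"])
  finally show ?thesis
    by (simp add: distrib_right sum.distrib sum_distrib_left)
qed

lemma Q_Lap: "Q g x = g x - Lap g x / N"
proof -
  have "Lap g x = (N * g x - (\<Sum>i\<in>I. g (\<sigma> i x))) / 2"
    by (simp add: Lap_def D_def sum_subtractf sum_const_I flip: sum_divide_distrib)
  then have "(\<Sum>i\<in>I. g (\<sigma> i x)) = N * g x - 2 * Lap g x"
    by simp
  then show ?thesis
    using N_pos by (simp add: Q_def diff_divide_distrib add_divide_distrib)
qed

lemma sum_Q: "(\<Sum>x\<in>X. Q g x) = (\<Sum>x\<in>X. g x)"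
proof -
  have "(\<Sum>x\<in>X. \<Sum>i\<in>I. g (\<sigma> i x)) = N * (\<Sum>x\<in>X. g x)"
    by (simp add: sum_flip_family[where g="\<lambda>i. g"] sum_const_I sum_distrib_left)
  then show ?thesis
    using N_pos
    by (simp add: Q_def sum.distrib flip: sum_divide_distrib)
qed

lemma D_parts: "i \<in> I \<Longrightarrow> (\<Sum>x\<in>X. D i g x * h x) = (\<Sum>x\<in>X. g x * D i h x)"
proof -
  assume i: "i \<in> I"
  have "(\<Sum>x\<in>X. g (\<sigma> i x) * h x) = (\<Sum>x\<in>X. g x * h (\<sigma> i x))"
    using sum_flip[OF i, of "\<lambda>x. g x * h (\<sigma> i x)"] by simp
  then show ?thesis
    by (simp add: D_def algebra_simps sum_subtractf diff_divide_distrib flip: sum_divide_distrib)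
qed

lemma Lap_parts: "(\<Sum>x\<in>X. Lap g x * h x) = (\<Sum>x\<in>X. g x * Lap h x)"
proof -
  have "(\<Sum>x\<in>X. Lap g x * h x) = (\<Sum>i\<in>I. \<Sum>x\<in>X. D i g x * h x)"
    by (simp add: Lap_def sum_distrib_right) (rule sum.swap)
  also have "\<dots> = (\<Sum>i\<in>I. \<Sum>x\<in>X. g x * D i h x)"
    by (intro sum.cong refl D_parts)
  also have "\<dots> = (\<Sum>x\<in>X. g x * Lap h x)"
    by (simp add: Lap_def sum_distrib_left) (rule sum.swap)
  finally show ?thesis .
qed

lemma Q_parts: "(\<Sum>x\<in>X. Q g x * h x) = (\<Sum>x\<in>X. g x * Q h x)"
  using Lap_parts[of g h]
  by (simp add: Q_Lap left_diff_distrib right_diff_distrib sum_subtractf flip: sum_divide_distrib)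

lemma D_sq: "(D i g (\<sigma> i x))\<^sup>2 = (D i g x)\<^sup>2"
  by (simp add: D_def power2_commute power_divide)

lemma Q_flip: "Q (\<lambda>x. g (\<sigma> i x)) = (\<lambda>x. Q g (\<sigma> i x))"
  by (auto simp: Q_def fun_eq_iff comm[of i])

lemma Q_add: "Q (\<lambda>x. g x + h x) = (\<lambda>x. Q g x + Q h x)"
  by (auto simp: Q_def fun_eq_iff sum.distrib add_divide_distrib)

lemma Q_cmult: "Q (\<lambda>x. c * g x) = (\<lambda>x. c * Q g x)"
  by (auto simp: Q_def fun_eq_iff algebra_simps sum_distrib_left)

lemma Q_diff: "Q (\<lambda>x. g x - h x) = (\<lambda>x. Q g x - Q h x)"
  using Q_add[of g "\<lambda>x. (-1) * h x"] Q_cmult[of "-1" h] by simp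

lemma Q_const [simp]: "Q (\<lambda>x. c) = (\<lambda>x. c)"
  using N_pos by (auto simp: Q_def fun_eq_iff sum_const_I)

lemma Q_sum: "Q (\<lambda>x. \<Sum>k\<in>K. g k x) = (\<lambda>x. \<Sum>k\<in>K. Q (g k) x)"
proof (induction K rule: infinite_finite_induct)
  case (insert k K)
  then show ?case by (simp add: Q_add)
qed simp_all

lemma Q_D: "Q (D i g) = D i (Q g)"
proof -
  have "D i g = (\<lambda>x. (1/2) * (g x - g (\<sigma> i x)))"
    by (simp add: D_def fun_eq_iff)
  then have "Q (D i g) = (\<lambda>x. (1/2) * (Q g x - Q g (\<sigma> i x)))"
    by (simp only: Q_cmult Q_diff Q_flip)
  then show ?thesis by (simp add: D_def fun_eq_iff)
qed

lemma Q_Lap_commute: "Q (Lap g) = Lap (Q g)"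
  by (simp add: Lap_def[abs_def] Q_sum Q_D)

lemma Q_mono: "(\<And>y. g y \<le> h y) \<Longrightarrow> Q g x \<le> Q h x"
  unfolding Q_def using N_pos
  by (intro divide_right_mono add_mono sum_mono) auto

lemma Q_ge_half: "(\<And>y. 0 \<le> g y) \<Longrightarrow> g x / 2 \<le> Q g x"
  unfolding Q_def using N_pos by (intro divide_right_mono) (auto intro!: sum_nonneg divide_nonneg_pos)

lemma Q_ge_neighbour:
  assumes "\<And>y. 0 \<le> g y" "i \<in> I" shows "g (\<sigma> i x) \<le> 2 * N * Q g x"
proof -
  have "g (\<sigma> i x) \<le> (\<Sum>i\<in>I. g (\<sigma> i x))"
    using assms finI by (intro member_le_sum) auto
  also have "\<dots> \<le> 2 * N * Q g x"
    using N_pos assms(1)[of x] by (simp add: Q_def distrib_left)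
  finally show ?thesis .
qed

lemma Q_pairs: "Q g x = (\<Sum>i\<in>I. g x + g (\<sigma> i x)) / (2 * N)"
  using N_pos by (simp add: Q_def sum.distrib sum_const_I field_simps)

lemma Q_pair_bound:
  assumes "\<And>i. i \<in> I \<Longrightarrow> b i \<le> g x + g (\<sigma> i x)"
  shows "(\<Sum>i\<in>I. b i) / (2 * N) \<le> Q g x"
  unfolding Q_pairs using N_pos assms by (intro divide_right_mono sum_mono) auto

lemma antisym_Q: "antisym_along i g \<Longrightarrow> antisym_along i (Q g)"
  using Q_cmult[of "-1" g] Q_flip[of g i]
  by (auto simp: antisym_along_def fun_eq_iff)

lemma antisym_D: "antisym_along i g \<Longrightarrow> antisym_along i (D j g)"
  by (auto simp: antisym_along_def D_def comm[of j i] field_simps)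

lemma antisym_D_eq: "antisym_along i g \<Longrightarrow> D i g = g"
  by (auto simp: antisym_along_def D_def)

text \<open>A function that changes sign under the flip \<open>j\<close> has no constant mode in direction \<open>j\<close>: the step
  along \<open>j\<close> cancels part of the lazy step instead of adding to it. The resulting \<open>L\<^sup>1\<close> spectral gap
  makes the flow forget such functions after order \<open>N\<close> steps, with no dependence on \<open>card X\<close>.\<close>

lemma antisym_Q_L1:
  assumes j: "j \<in> I" and g: "antisym_along j g"
  shows "(\<Sum>x\<in>X. \<bar>Q g x\<bar>) \<le> (1 - 1 / N) * (\<Sum>x\<in>X. \<bar>g x\<bar>)"
proof -
  let ?A = "\<Sum>x\<in>X. \<bar>g x\<bar>"
  have pt: "\<bar>Q g x\<bar> \<le> ((1 - 1 / N) * \<bar>g x\<bar> + (\<Sum>i\<in>I-{j}. \<bar>g (\<sigma> i x)\<bar>) / N) / 2" for x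
  proof -
    have split: "(\<Sum>i\<in>I. g (\<sigma> i x)) = (\<Sum>i\<in>I-{j}. g (\<sigma> i x)) - g x"
      using sum.remove[OF finI j, of "\<lambda>i. g (\<sigma> i x)"] g by (simp add: antisym_along_def)
    have "Q g x = ((1 - 1 / N) * g x + (\<Sum>i\<in>I-{j}. g (\<sigma> i x)) / N) / 2"
      by (simp add: Q_def split left_diff_distrib diff_divide_distrib)
    also have "\<bar>\<dots>\<bar> \<le> ((1 - 1 / N) * \<bar>g x\<bar> + (\<Sum>i\<in>I-{j}. \<bar>g (\<sigma> i x)\<bar>) / N) / 2"
    proof -
      have "\<bar>(1 - 1 / N) * g x\<bar> = (1 - 1 / N) * \<bar>g x\<bar>"
        using N_ge_1 by (simp add: abs_mult)
      moreover have "\<bar>(\<Sum>i\<in>I-{j}. g (\<sigma> i x)) / N\<bar> \<le> (\<Sum>i\<in>I-{j}. \<bar>g (\<sigma> i x)\<bar>) / N"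
        using N_pos by (simp add: divide_right_mono)
      ultimately show ?thesis
        using abs_triangle_ineq[of "(1 - 1 / N) * g x" "(\<Sum>i\<in>I-{j}. g (\<sigma> i x)) / N"]
        by simp
    qed
    finally show ?thesis .
  qed
  have "(\<Sum>x\<in>X. \<Sum>i\<in>I-{j}. \<bar>g (\<sigma> i x)\<bar>) = (\<Sum>i\<in>I-{j}. \<Sum>x\<in>X. \<bar>g (\<sigma> i x)\<bar>)"
    by (rule sum.swap)
  also have "\<dots> = (\<Sum>i\<in>I-{j}. ?A)"
    by (intro sum.cong refl sum_flip) auto
  also have "\<dots> = (N - 1) * ?A"
    using j finI neI by (simp add: card_Diff_singleton of_nat_diff Suc_leI card_gt_0_iff)
  finally have nb: "(\<Sum>x\<in>X. \<Sum>i\<in>I-{j}. \<bar>g (\<sigma> i x)\<bar>) = (N - 1) * ?A" .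
  have "(\<Sum>x\<in>X. \<bar>Q g x\<bar>) \<le> (\<Sum>x\<in>X. ((1 - 1 / N) * \<bar>g x\<bar> + (\<Sum>i\<in>I-{j}. \<bar>g (\<sigma> i x)\<bar>) / N) / 2)"
    by (rule sum_mono) (rule pt)
  also have "\<dots> = ((1 - 1 / N) * ?A + (N - 1) * ?A / N) / 2"
    by (simp add: sum.distrib nb flip: sum_divide_distrib sum_distrib_left)
  also have "\<dots> = (1 - 1 / N) * ?A"
    using N_pos by (simp add: field_simps)
  finally show ?thesis .
qed

text \<open>Averaging a vector field cannot beat averaging a pointwise bound on its length: pair the averaged
  vector with itself and use Cauchy-Schwarz under the average.\<close>

lemma Q_norm_le:
  assumes "\<And>y. L2_set (\<lambda>i. V i y) I \<le> u y"
  shows "L2_set (\<lambda>i. Q (V i) x) I \<le> Q u x"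
proof -
  let ?A = "L2_set (\<lambda>i. Q (V i) x) I"
  have A0: "0 \<le> ?A" by simp
  have "?A\<^sup>2 = (\<Sum>i\<in>I. Q (V i) x * Q (V i) x)"
    by (simp add: L2_set_def sum_nonneg power2_eq_square)
  also have "\<dots> = Q (\<lambda>y. \<Sum>i\<in>I. Q (V i) x * V i y) x"
    by (simp add: Q_sum Q_cmult)
  also have "\<dots> \<le> Q (\<lambda>y. ?A * u y) x"
  proof (rule Q_mono)
    fix y
    have "(\<Sum>i\<in>I. Q (V i) x * V i y) \<le> (\<Sum>i\<in>I. \<bar>Q (V i) x\<bar> * \<bar>V i y\<bar>)"
      by (intro sum_mono) (metis abs_ge_self abs_mult)
    also have "\<dots> \<le> ?A * L2_set (\<lambda>i. V i y) I"
      by (rule L2_set_mult_ineq)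
    also have "\<dots> \<le> ?A * u y"
      using assms A0 by (intro mult_left_mono) auto
    finally show "(\<Sum>i\<in>I. Q (V i) x * V i y) \<le> ?A * u y" .
  qed
  also have "\<dots> = ?A * Q u x"
    by (simp add: Q_cmult)
  finally have le: "?A * ?A \<le> ?A * Q u x"
    by (simp add: power2_eq_square)
  have "0 \<le> u y" for y
    using assms[of y] L2_set_nonneg[of "\<lambda>i. V i y" I] by linarith
  then have "0 \<le> Q u x"
    using Q_mono[of "\<lambda>y. 0" u x] by simp
  with le A0 show ?thesis
    by (cases "?A = 0") (auto simp: mult_le_cancel_left)
qed

lemma Qpow_D: "D i ((Q ^^ t) g) = (Q ^^ t) (D i g)"
  by (induction t) (simp_all add: Q_D[symmetric])

lemma Qpow_Lap: "Lap ((Q ^^ t) g) = (Q ^^ t) (Lap g)"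
  by (induction t) (simp_all add: Q_Lap_commute[symmetric])

lemma Qpow_sum: "(Q ^^ t) (\<lambda>x. \<Sum>k\<in>K. g k x) = (\<lambda>x. \<Sum>k\<in>K. (Q ^^ t) (g k) x)"
  by (induction t) (simp_all add: Q_sum)

lemma Qpow_cmult: "(Q ^^ t) (\<lambda>x. c * g x) = (\<lambda>x. c * (Q ^^ t) g x)"
  by (induction t) (simp_all add: Q_cmult)

lemma Qpow_mono: "(\<And>y. g y \<le> h y) \<Longrightarrow> (Q ^^ t) g x \<le> (Q ^^ t) h x"
  by (induction t arbitrary: x) (simp_all add: Q_mono)

lemma Qpow_const [simp]: "(Q ^^ t) (\<lambda>x. c) = (\<lambda>x. c)"
  by (induction t) simp_all

lemma sum_Qpow: "(\<Sum>x\<in>X. (Q ^^ t) g x) = (\<Sum>x\<in>X. g x)"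
  by (induction t) (simp_all add: sum_Q)

lemma antisym_Qpow: "antisym_along i g \<Longrightarrow> antisym_along i ((Q ^^ t) g)"
  by (induction t) (simp_all add: antisym_Q)

lemma Qpow_norm_le:
  assumes "\<And>y. L2_set (\<lambda>i. V i y) I \<le> u y"
  shows "L2_set (\<lambda>i. (Q ^^ t) (V i) x) I \<le> (Q ^^ t) u x"
  using assms by (induction t arbitrary: x) (auto intro: Q_norm_le)

lemma antisym_Qpow_L1:
  assumes "j \<in> I" "antisym_along j g"
  shows "(\<Sum>x\<in>X. \<bar>(Q ^^ t) g x\<bar>) \<le> (1 - 1 / N) ^ t * (\<Sum>x\<in>X. \<bar>g x\<bar>)"
proof (induction t)
  case (Suc t)
  have "(\<Sum>x\<in>X. \<bar>(Q ^^ Suc t) g x\<bar>) \<le> (1 - 1 / N) * (\<Sum>x\<in>X. \<bar>(Q ^^ t) g x\<bar>)"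
    using antisym_Q_L1[OF assms(1) antisym_Qpow[OF assms(2), of t]] by simp
  also have "\<dots> \<le> (1 - 1 / N) * ((1 - 1 / N) ^ t * (\<Sum>x\<in>X. \<bar>g x\<bar>))"
    using N_ge_1 Suc by (intro mult_left_mono) auto
  finally show ?case by (simp add: mult.assoc)
qed simp

lemma decay_constant: "(1 - 1 / N) ^ (2 * card I) \<le> 1 / 4"
proof -
  have "(1 - 1 / N) ^ card I \<le> exp (- (1 / N)) ^ card I"
    using N_ge_1 exp_ge_add_one_self[of "- (1 / N)"] by (intro power_mono) auto
  also have "\<dots> = exp (- 1)"
    using N_pos by (simp flip: exp_of_nat_mult)
  also have "\<dots> \<le> 1 / 2"
    using exp_ge_add_one_self[of 1] by (simp add: exp_minus field_simps)
  finally have "(1 - 1 / N) ^ card I \<le> 1 / 2" .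
  then have "((1 - 1 / N) ^ card I)\<^sup>2 \<le> (1 / 2)\<^sup>2"
    using N_ge_1 by (intro power_mono) auto
  then show ?thesis
    by (simp add: power_even_eq power_divide)
qed

text \<open>The pairing of \<open>f\<close> and \<open>H\<close> is written as the sum of its losses along the flow of both functions.
  Since \<open>Q\<close> is self-adjoint, one step loses
  \<open>\<langle>f, H\<rangle> - \<langle>Q f, Q H\<rangle> = \<langle>f - Q f, H + Q H\<rangle>\<close>.\<close>

lemma duhamel:
  "(\<Sum>x\<in>X. f x * H x) =
     (\<Sum>t<T. \<Sum>x\<in>X. Lap ((Q ^^ t) f) x * ((Q ^^ t) H x + (Q ^^ Suc t) H x)) / N
     + (\<Sum>x\<in>X. (Q ^^ T) f x * (Q ^^ T) H x)"
proof (induction T)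
  case (Suc T)
  let ?f = "(Q ^^ T) f" and ?H = "(Q ^^ T) H"
  have "(\<Sum>x\<in>X. ?f x * ?H x) - (\<Sum>x\<in>X. Q ?f x * Q ?H x)
      = (\<Sum>x\<in>X. (?f x - Q ?f x) * ?H x) + ((\<Sum>x\<in>X. Q ?f x * ?H x) - (\<Sum>x\<in>X. Q ?f x * Q ?H x))"
    by (simp add: algebra_simps sum_subtractf sum.distrib)
  also have "(\<Sum>x\<in>X. Q ?f x * ?H x) = (\<Sum>x\<in>X. ?f x * Q ?H x)"
    by (rule Q_parts)
  also have "(\<Sum>x\<in>X. (?f x - Q ?f x) * ?H x)
      + ((\<Sum>x\<in>X. ?f x * Q ?H x) - (\<Sum>x\<in>X. Q ?f x * Q ?H x))
      = (\<Sum>x\<in>X. (?f x - Q ?f x) * (?H x + Q ?H x))"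
    by (simp add: algebra_simps sum_subtractf sum.distrib)
  also have "\<dots> = (\<Sum>x\<in>X. Lap ?f x * (?H x + Q ?H x)) / N"
    by (simp add: Q_Lap sum_divide_distrib)
  finally have "(\<Sum>x\<in>X. ?f x * ?H x) =
      (\<Sum>x\<in>X. Lap ?f x * (?H x + Q ?H x)) / N + (\<Sum>x\<in>X. Q ?f x * Q ?H x)"
    by simp
  with Suc show ?case
    by (simp add: add_divide_distrib)
qed simp

end

section \<open>Inequalities on a single edge\<close>

text \<open>The convex function that agrees with \<open>s ln s - s + 1\<close> up to \<open>M\<close> and continues along its tangent
  beyond \<open>M\<close>. The cap makes it grow only like \<open>s ln M\<close>, which is where the final logarithm
  comes from.\<close>

definition capped_entropy :: "real \<Rightarrow> real \<Rightarrow> real" where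
  "capped_entropy M s = s * ln (min s M) - min s M + 1"

text \<open>A scaled relative entropy dominates a scaled Hellinger distance, by \<open>ln x \<le> x - 1\<close> at
  \<open>x = sqrt (r / s)\<close>.\<close>

lemma log_gap:
  fixes s r :: real assumes "0 < s" "0 < r"
  shows "(sqrt s - sqrt r)\<^sup>2 \<le> s * ln (s / r) - s + r"
proof -
  have q: "0 < sqrt (r / s)" using assms by simp
  have "ln (r / s) = 2 * ln (sqrt (r / s))"
    using assms by (simp add: ln_sqrt)
  also have "\<dots> \<le> 2 * (sqrt (r / s) - 1)"
    using ln_le_minus_one[OF q] by simp
  finally have "- ln (s / r) \<le> 2 * (sqrt (r / s) - 1)"
    using assms by (simp add: ln_div)
  then have "s * (2 * (1 - sqrt (r / s))) \<le> s * ln (s / r)"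
    using assms by (intro mult_left_mono) auto
  moreover have "s * sqrt (r / s) = sqrt s * sqrt r"
  proof -
    have "s * sqrt (r / s) = (sqrt s * sqrt s) * (sqrt r / sqrt s)"
      using assms by (simp add: real_sqrt_divide)
    also have "\<dots> = sqrt s * sqrt r" using assms by (simp del: real_sqrt_mult_self)
    finally show ?thesis .
  qed
  ultimately have "2 * s - 2 * (sqrt s * sqrt r) \<le> s * ln (s / r)"
    by (simp add: algebra_simps)
  moreover have "(sqrt s - sqrt r)\<^sup>2 = s - 2 * (sqrt s * sqrt r) + r"
    using assms by (simp add: power2_diff)
  ultimately show ?thesis by linarith
qed

text \<open>The right-hand side is the distance from the capped entropy to its tangent at \<open>r\<close>. Tangents at
  points up to \<open>M\<close> suffice to recover it, so this is a quantitative form of its convexity.\<close>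

lemma capped_entropy_gap:
  assumes "0 < s" "0 < r" "r \<le> M"
  shows "(sqrt (min s M) - sqrt r)\<^sup>2 \<le> capped_entropy M s - (s * ln r - r + 1)"
proof -
  let ?m = "min s M"
  have m: "0 < ?m" "?m \<le> s" using assms by auto
  have "(sqrt ?m - sqrt r)\<^sup>2 \<le> ?m * ln (?m / r) - ?m + r"
    using log_gap[OF m(1) assms(2)] .
  also have "?m * ln (?m / r) \<le> s * ln (?m / r)"
  proof (cases "s \<le> M")
    case False
    then have "0 \<le> ln (?m / r)" using assms by simp
    then show ?thesis using m by (intro mult_right_mono) auto
  qed simp
  also have "s * ln (?m / r) = s * ln ?m - s * ln r"
    using m assms by (simp add: ln_div algebra_simps)
  finally show ?thesis by (simp add: capped_entropy_def)
qed

lemma capped_entropy_nonneg: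
  assumes "0 < s" "1 \<le> M" shows "0 \<le> capped_entropy M s"
proof -
  have "(sqrt (min s M) - 1)\<^sup>2 \<le> capped_entropy M s"
    using capped_entropy_gap[of s 1 M] assms by simp
  then show ?thesis by (rule order_trans[OF zero_le_power2])
qed

lemma capped_entropy_le:
  assumes "1 \<le> s" "1 \<le> M" shows "capped_entropy M s \<le> (s - 1) * ln M"
proof -
  let ?m = "min s M"
  have m: "1 \<le> ?m" "?m \<le> M" using assms by auto
  have "capped_entropy M s = (s - 1) * ln ?m + (ln ?m - ?m + 1)"
    by (simp add: capped_entropy_def algebra_simps)
  also have "ln ?m - ?m + 1 \<le> 0" using ln_le_minus_one[of ?m] m by simp
  also have "(s - 1) * ln ?m \<le> (s - 1) * ln M"
    using m assms by (intro mult_left_mono) auto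
  finally show ?thesis by simp
qed

lemma parallel_weights:
  fixes p q a b :: real assumes "0 < p" "0 < q"
  shows "min p q / 2 * (a - b)\<^sup>2 \<le> p * a\<^sup>2 + q * b\<^sup>2"
proof -
  have "(a - b)\<^sup>2 \<le> 2 * a\<^sup>2 + 2 * b\<^sup>2"
    using zero_le_power2[of "a + b"] by (simp add: power2_sum power2_diff)
  then have "min p q / 2 * (a - b)\<^sup>2 \<le> min p q / 2 * (2 * a\<^sup>2 + 2 * b\<^sup>2)"
    using assms by (intro mult_left_mono) auto
  also have "\<dots> = min p q * a\<^sup>2 + min p q * b\<^sup>2" by (simp add: algebra_simps)
  also have "\<dots> \<le> p * a\<^sup>2 + q * b\<^sup>2"
    by (intro add_mono mult_right_mono) auto
  finally show ?thesis .
qed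

lemma sq_diff_le_sqrt:
  fixes s r :: real assumes "0 \<le> s" "0 \<le> r"
  shows "(s - r)\<^sup>2 \<le> 4 * max s r * (sqrt s - sqrt r)\<^sup>2"
proof -
  let ?m = "sqrt (max s r)"
  have "sqrt s + sqrt r \<le> 2 * ?m"
    using real_sqrt_le_mono[OF max.cobounded1[of s r]] real_sqrt_le_mono[OF max.cobounded2[of r s]]
    by linarith
  then have "(sqrt s + sqrt r)\<^sup>2 \<le> (2 * ?m)\<^sup>2"
    using assms by (intro power_mono) auto
  then have "(sqrt s + sqrt r)\<^sup>2 \<le> 4 * max s r"
    using assms by (simp add: power_mult_distrib)
  then have "(sqrt s + sqrt r)\<^sup>2 * (sqrt s - sqrt r)\<^sup>2 \<le> 4 * max s r * (sqrt s - sqrt r)\<^sup>2"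
    by (intro mult_right_mono) auto
  moreover have "(sqrt s + sqrt r)\<^sup>2 * (sqrt s - sqrt r)\<^sup>2 = (s - r)\<^sup>2"
  proof -
    have "(sqrt s + sqrt r) * (sqrt s - sqrt r) = s - r"
      using assms by (simp add: algebra_simps)
    then show ?thesis by (metis power_mult_distrib)
  qed
  ultimately show ?thesis by simp
qed

text \<open>An increment of \<open>a\<close> comes either from the direction field \<open>a / s\<close> or from the length bound \<open>s\<close>:
  with \<open>r \<le> s\<close>, the difference \<open>a - b\<close> is \<open>r (a / s - b / r) + (s - r) (a / s)\<close>. Each part is measured
  relative to the larger end of the edge, and this is what the two energies below can pay for.\<close>

lemma vector_edge_bound:
  fixes a b :: "'i \<Rightarrow> real" and s r :: real
  assumes s: "0 < s" and r: "0 < r" 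
    and a: "(\<Sum>i\<in>I. (a i)\<^sup>2) \<le> s\<^sup>2" and b: "(\<Sum>i\<in>I. (b i)\<^sup>2) \<le> r\<^sup>2"
  shows "(\<Sum>i\<in>I. ((a i - b i) / 2)\<^sup>2)
    \<le> (s + r) * (min s r * (\<Sum>i\<in>I. (a i / s - b i / r)\<^sup>2) / 2 + 2 * (sqrt s - sqrt r)\<^sup>2)"
proof -
  have main: "(\<Sum>i\<in>I. ((a i - b i) / 2)\<^sup>2)
    \<le> (s + r) * (min s r * (\<Sum>i\<in>I. (a i / s - b i / r)\<^sup>2) / 2 + 2 * (sqrt s - sqrt r)\<^sup>2)"
    if sr: "r \<le> s" and r: "0 < r" and a: "(\<Sum>i\<in>I. (a i)\<^sup>2) \<le> s\<^sup>2"
    for a b :: "'i \<Rightarrow> real" and s r :: real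
  proof -
    let ?W = "\<Sum>i\<in>I. (a i / s - b i / r)\<^sup>2"
    have s: "0 < s" using sr r by simp
    have "((a i - b i) / 2)\<^sup>2 \<le> r\<^sup>2 * (a i / s - b i / r)\<^sup>2 / 2 + (s - r)\<^sup>2 / s\<^sup>2 * (a i)\<^sup>2 / 2" for i
    proof -
      let ?p = "r * (a i / s - b i / r)" and ?q = "(s - r) / s * a i"
      have "a i - b i = ?p + ?q" using s r by (simp add: field_simps)
      moreover have "(?p + ?q)\<^sup>2 \<le> 2 * ?p\<^sup>2 + 2 * ?q\<^sup>2"
        using zero_le_power2[of "?p - ?q"] by (simp only: power2_sum power2_diff)
      ultimately show ?thesis by (simp add: power_divide power_mult_distrib mult.commute)
    qed
    then have "(\<Sum>i\<in>I. ((a i - b i) / 2)\<^sup>2)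
        \<le> (\<Sum>i\<in>I. r\<^sup>2 * (a i / s - b i / r)\<^sup>2 / 2 + (s - r)\<^sup>2 / s\<^sup>2 * (a i)\<^sup>2 / 2)"
      by (rule sum_mono)
    also have "\<dots> = r\<^sup>2 * ?W / 2 + (s - r)\<^sup>2 / s\<^sup>2 * (\<Sum>i\<in>I. (a i)\<^sup>2) / 2"
      by (simp add: sum.distrib sum_distrib_left sum_divide_distrib)
    also have "\<dots> \<le> r\<^sup>2 * ?W / 2 + (s - r)\<^sup>2 / s\<^sup>2 * s\<^sup>2 / 2"
      using a by (intro add_left_mono divide_right_mono mult_left_mono) auto
    also have "\<dots> = r * (r * ?W) / 2 + (s - r)\<^sup>2 / 2"
      using s by (simp add: power2_eq_square)
    also have "\<dots> \<le> s * (r * ?W) / 2 + 4 * s * (sqrt s - sqrt r)\<^sup>2 / 2"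
      using sq_diff_le_sqrt[of s r] s r sr
      by (intro add_mono divide_right_mono mult_right_mono) (auto intro!: mult_nonneg_nonneg sum_nonneg simp: max_def)
    also have "\<dots> = s * (r * ?W / 2 + 2 * (sqrt s - sqrt r)\<^sup>2)"
      by (simp add: algebra_simps)
    also have "\<dots> \<le> (s + r) * (r * ?W / 2 + 2 * (sqrt s - sqrt r)\<^sup>2)"
      using r by (intro mult_right_mono) (auto intro!: add_nonneg_nonneg mult_nonneg_nonneg sum_nonneg)
    finally show ?thesis using sr by (simp only: min_absorb2)
  qed
  show ?thesis
  proof (cases "r \<le> s")
    case True
    then show ?thesis by (rule main[OF _ r a])
  next
    case False
    then have "s \<le> r" by simp
    from main[OF this s b] show ?thesis
      by (simp add: power2_commute[of "b _ / r"] power2_commute[of "sqrt r"] power_divide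
          power2_commute[of "b _"] min.commute add.commute)
  qed
qed

section \<open>Energy released by a field along the walk\<close>

context involution_walk begin

text \<open>Up to a constant, a lower bound for the energy that averaging by \<open>Q\<close> releases from the capped entropy of \<open>u\<close> along one edge. The cap inside the square roots makes it
  insensitive to the values of \<open>u\<close> above \<open>M\<close>.\<close>

definition hellinger :: "real \<Rightarrow> ('a \<Rightarrow> real) \<Rightarrow> 'i \<Rightarrow> 'a \<Rightarrow> real" where
  "hellinger M u j x = (sqrt (min (u x) M) - sqrt (min (u (\<sigma> j x)) M))\<^sup>2"

text \<open>Up to a constant, a lower bound for the energy that averaging releases from \<open>|V|\<^sup>2 / u\<close> along one edge; it only sees the normalised field \<open>V / u\<close>.\<close>

definition slope :: "('i \<Rightarrow> 'a \<Rightarrow> real) \<Rightarrow> ('a \<Rightarrow> real) \<Rightarrow> 'i \<Rightarrow> 'a \<Rightarrow> real" where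
  "slope V u j x = min (u x) (u (\<sigma> j x)) *
     (\<Sum>i\<in>I. (V i x / u x - V i (\<sigma> j x) / u (\<sigma> j x))\<^sup>2)"

lemma hellinger_nonneg [simp]: "0 \<le> hellinger M u j x"
  by (simp add: hellinger_def)

lemma slope_nonneg: "(\<And>y. 0 < u y) \<Longrightarrow> 0 \<le> slope V u j x"
  unfolding slope_def by (intro mult_nonneg_nonneg sum_nonneg) (auto intro: less_imp_le)

lemma Q_pos: "(\<And>y. 0 < u y) \<Longrightarrow> 0 < Q u x"
  using Q_ge_half[of u x] by (smt (verit) field_sum_of_halves)

text \<open>Jensen's inequality for the capped entropy, keeping the remainder: the values of \<open>u\<close> near \<open>x\<close> are compared
  with the tangent at their average \<open>Q u x\<close>, and the lazy half of the walk puts both ends of every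
  edge at \<open>x\<close> under the average.\<close>

lemma entropy_dissipation:
  assumes u: "\<And>y. 0 < u y" and M: "0 < M"
  shows "(\<Sum>x\<in>X. \<Sum>j\<in>I. hellinger M u j x) / N
    \<le> 4 * ((\<Sum>x\<in>X. capped_entropy M (u x)) - (\<Sum>x\<in>X. capped_entropy M (Q u x)))"
proof -
  have pt: "(\<Sum>j\<in>I. hellinger M u j x / 2) / (2 * N)
      \<le> Q (\<lambda>y. capped_entropy M (u y)) x - capped_entropy M (Q u x)" for x
  proof -
    let ?r = "min (Q u x) M"
    have r: "0 < ?r" "?r \<le> M" using Q_pos[OF u] M by auto
    let ?g = "\<lambda>y. (sqrt (min (u y) M) - sqrt ?r)\<^sup>2"
    have "(\<Sum>j\<in>I. hellinger M u j x / 2) / (2 * N) \<le> Q ?g x"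
    proof (rule Q_pair_bound)
      fix j
      show "hellinger M u j x / 2 \<le> ?g x + ?g (\<sigma> j x)"
        using parallel_weights[of 1 1 "sqrt (min (u x) M) - sqrt ?r" "sqrt (min (u (\<sigma> j x)) M) - sqrt ?r"]
        by (simp add: hellinger_def)
    qed
    also have "\<dots> \<le> Q (\<lambda>y. capped_entropy M (u y) - (ln ?r * u y + (1 - ?r))) x"
    proof (rule Q_mono)
      fix y show "?g y \<le> capped_entropy M (u y) - (ln ?r * u y + (1 - ?r))"
        using capped_entropy_gap[OF u r, of y] by (simp add: mult.commute)
    qed
    also have "\<dots> = Q (\<lambda>y. capped_entropy M (u y)) x - (ln ?r * Q u x + (1 - ?r))"
      by (simp add: Q_diff Q_add Q_cmult)
    also have "ln ?r * Q u x + (1 - ?r) = capped_entropy M (Q u x)"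
      by (simp add: capped_entropy_def)
    finally show ?thesis .
  qed
  have "(\<Sum>x\<in>X. \<Sum>j\<in>I. hellinger M u j x) / N = 4 * (\<Sum>x\<in>X. (\<Sum>j\<in>I. hellinger M u j x / 2) / (2 * N))"
    by (simp add: sum_divide_distrib[symmetric] field_simps)
  also have "\<dots> \<le> 4 * (\<Sum>x\<in>X. Q (\<lambda>y. capped_entropy M (u y)) x - capped_entropy M (Q u x))"
    by (intro mult_left_mono sum_mono pt) auto
  finally show ?thesis by (simp add: sum_subtractf sum_Q)
qed

text \<open>The same argument for the jointly convex function \<open>|V|\<^sup>2 / u\<close>, whose tangent at the averaged point
  is \<open>2 \<xi> \<bullet> V - |\<xi>|\<^sup>2 u\<close> with \<open>\<xi> = Q V / Q u\<close>.\<close>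

lemma quotient_dissipation:
  assumes u: "\<And>y. 0 < u y"
  shows "(\<Sum>x\<in>X. \<Sum>j\<in>I. slope V u j x) / N
    \<le> 4 * ((\<Sum>x\<in>X. (\<Sum>i\<in>I. (V i x)\<^sup>2) / u x) - (\<Sum>x\<in>X. (\<Sum>i\<in>I. (Q (V i) x)\<^sup>2) / Q u x))"
proof -
  have pt: "(\<Sum>j\<in>I. slope V u j x / 2) / (2 * N)
      \<le> Q (\<lambda>y. (\<Sum>i\<in>I. (V i y)\<^sup>2) / u y) x - (\<Sum>i\<in>I. (Q (V i) x)\<^sup>2) / Q u x" for x
  proof -
    define \<xi> where "\<xi> i = Q (V i) x / Q u x" for i
    have Qu: "0 < Q u x" by (rule Q_pos[OF u])
    let ?g = "\<lambda>y. \<Sum>i\<in>I. u y * (V i y / u y - \<xi> i)\<^sup>2"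
    have "(\<Sum>j\<in>I. slope V u j x / 2) / (2 * N) \<le> Q ?g x"
    proof (rule Q_pair_bound)
      fix j
      have "slope V u j x / 2 = (\<Sum>i\<in>I. min (u x) (u (\<sigma> j x)) / 2 *
          ((V i x / u x - \<xi> i) - (V i (\<sigma> j x) / u (\<sigma> j x) - \<xi> i))\<^sup>2)"
        by (simp add: slope_def sum_distrib_left sum_divide_distrib)
      also have "\<dots> \<le> (\<Sum>i\<in>I. u x * (V i x / u x - \<xi> i)\<^sup>2
          + u (\<sigma> j x) * (V i (\<sigma> j x) / u (\<sigma> j x) - \<xi> i)\<^sup>2)"
        by (intro sum_mono parallel_weights u)
      finally show "slope V u j x / 2 \<le> ?g x + ?g (\<sigma> j x)"
        by (simp add: sum.distrib)
    qed
    also have "?g = (\<lambda>y. \<Sum>i\<in>I. (V i y)\<^sup>2 / u y - (2 * \<xi> i) * V i y + (\<xi> i)\<^sup>2 * u y)"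
    proof (intro ext sum.cong refl)
      fix y i
      show "u y * (V i y / u y - \<xi> i)\<^sup>2 = (V i y)\<^sup>2 / u y - (2 * \<xi> i) * V i y + (\<xi> i)\<^sup>2 * u y"
        using u[of y] by (simp add: power2_eq_square field_simps)
    qed
    also have "Q \<dots> x = (\<Sum>i\<in>I. Q (\<lambda>y. (V i y)\<^sup>2 / u y) x - (2 * \<xi> i) * Q (V i) x + (\<xi> i)\<^sup>2 * Q u x)"
      by (simp only: Q_sum Q_add Q_diff Q_cmult)
    also have "\<dots> = (\<Sum>i\<in>I. Q (\<lambda>y. (V i y)\<^sup>2 / u y) x - (Q (V i) x)\<^sup>2 / Q u x)"
      using Qu by (intro sum.cong refl) (simp add: \<xi>_def power2_eq_square field_simps)
    also have "\<dots> = Q (\<lambda>y. (\<Sum>i\<in>I. (V i y)\<^sup>2) / u y) x - (\<Sum>i\<in>I. (Q (V i) x)\<^sup>2) / Q u x"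
      by (simp add: sum_subtractf sum_divide_distrib Q_sum)
    finally show ?thesis .
  qed
  have "(\<Sum>x\<in>X. \<Sum>j\<in>I. slope V u j x) / N = 4 * (\<Sum>x\<in>X. (\<Sum>j\<in>I. slope V u j x / 2) / (2 * N))"
    by (simp add: sum_divide_distrib[symmetric] field_simps)
  also have "\<dots> \<le> 4 * (\<Sum>x\<in>X. Q (\<lambda>y. (\<Sum>i\<in>I. (V i y)\<^sup>2) / u y) x - (\<Sum>i\<in>I. (Q (V i) x)\<^sup>2) / Q u x)"
    by (intro mult_left_mono sum_mono pt) auto
  finally show ?thesis by (simp add: sum_subtractf sum_Q)
qed

text \<open>The combination of the two energies that dominates an increment of \<open>V\<close>; the coefficients are
  those of \<open>vector_edge_bound\<close>.\<close>

definition edge_energy :: "real \<Rightarrow> ('i \<Rightarrow> 'a \<Rightarrow> real) \<Rightarrow> ('a \<Rightarrow> real) \<Rightarrow> 'i \<Rightarrow> 'a \<Rightarrow> real" where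
  "edge_energy M V u j x = slope V u j x / 2 + 2 * hellinger M u j x"

lemma edge_energy_nonneg: "(\<And>y. 0 < u y) \<Longrightarrow> 0 \<le> edge_energy M V u j x"
  using slope_nonneg[of u V j x] by (simp add: edge_energy_def)

lemma edge_energy_bound:
  assumes u: "\<And>y. 0 < u y" and V: "\<And>y. L2_set (\<lambda>i. V i y) I \<le> u y"
    and M: "u x \<le> M" "u (\<sigma> j x) \<le> M"
  shows "(\<Sum>i\<in>I. (D j (V i) x)\<^sup>2)
    \<le> (min (u x) M + min (u (\<sigma> j x)) M) * edge_energy M V u j x"
proof -
  have sq: "(\<Sum>i\<in>I. (V i y)\<^sup>2) \<le> (u y)\<^sup>2" for y
  proof -
    have "(L2_set (\<lambda>i. V i y) I)\<^sup>2 \<le> (u y)\<^sup>2"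
      using V by (intro power_mono) auto
    then show ?thesis by (simp add: L2_set_def sum_nonneg)
  qed
  show ?thesis
    using vector_edge_bound[OF u u sq sq, of x "\<sigma> j x"] M
    by (simp add: D_def edge_energy_def slope_def hellinger_def min_absorb1)
qed

lemma telescope_bound:
  fixes a :: "nat \<Rightarrow> real"
  assumes "\<And>t. e t \<le> 4 * (a t - a (Suc t))" "\<And>t. 0 \<le> a t" "a 0 \<le> A"
  shows "(\<Sum>t<T. e t) \<le> 4 * A"
proof -
  have "(\<Sum>t<T. e t) \<le> (\<Sum>t<T. 4 * (a t - a (Suc t)))"
    by (intro sum_mono assms)
  also have "\<dots> = 4 * (a 0 - a T)"
    by (simp only: sum_lessThan_telescope' flip: sum_distrib_left)
  finally show ?thesis using assms(2)[of T] assms(3) by simp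
qed

lemma Qpow_pos: "(\<And>y. 0 < u y) \<Longrightarrow> 0 < (Q ^^ t) u x"
  by (induction t arbitrary: x) (simp_all add: Q_pos)

lemma Qpow_ge_1: "(\<And>y. 1 \<le> u y) \<Longrightarrow> 1 \<le> (Q ^^ t) u x"
  using Qpow_mono[of "\<lambda>y. 1" u t x] by simp

text \<open>Subtracting \<open>1\<close> from \<open>u\<close> matters: the normalisation makes the entropy vanish where \<open>u = 1\<close>, so a constant background
  added to a field costs nothing, however large the set \<open>X\<close> is.\<close>

lemma total_hellinger:
  assumes u: "\<And>y. 1 \<le> u y" and M: "1 \<le> M"
  shows "(\<Sum>t<T. (\<Sum>x\<in>X. \<Sum>j\<in>I. hellinger M ((Q ^^ t) u) j x) / N) \<le> 4 * (ln M * (\<Sum>x\<in>X. u x - 1))"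
proof (rule telescope_bound[where a="\<lambda>t. \<Sum>x\<in>X. capped_entropy M ((Q ^^ t) u x)"])
  have up: "\<And>y. 0 < u y" using u by (smt (verit))
  show "(\<Sum>x\<in>X. \<Sum>j\<in>I. hellinger M ((Q ^^ t) u) j x) / N
    \<le> 4 * ((\<Sum>x\<in>X. capped_entropy M ((Q ^^ t) u x)) - (\<Sum>x\<in>X. capped_entropy M ((Q ^^ Suc t) u x)))" for t
    using entropy_dissipation[of "(Q ^^ t) u" M] Qpow_pos[OF up] M by simp
  show "0 \<le> (\<Sum>x\<in>X. capped_entropy M ((Q ^^ t) u x))" for t
    using Qpow_pos[OF up] M by (intro sum_nonneg capped_entropy_nonneg) auto
  have "(\<Sum>x\<in>X. capped_entropy M (u x)) \<le> (\<Sum>x\<in>X. ln M * (u x - 1))"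
    using capped_entropy_le[OF u M] by (intro sum_mono) (simp add: mult.commute)
  then show "(\<Sum>x\<in>X. capped_entropy M ((Q ^^ 0) u x)) \<le> ln M * (\<Sum>x\<in>X. u x - 1)"
    by (simp add: sum_distrib_left)
qed

lemma total_slope:
  assumes u: "\<And>y. 0 < u y" and V: "\<And>y. L2_set (\<lambda>i. V i y) I \<le> u y"
  shows "(\<Sum>t<T. (\<Sum>x\<in>X. \<Sum>j\<in>I. slope (\<lambda>i. (Q ^^ t) (V i)) ((Q ^^ t) u) j x) / N)
     \<le> 4 * (\<Sum>x\<in>X. L2_set (\<lambda>i. V i x) I)"
proof (rule telescope_bound[where a="\<lambda>t. \<Sum>x\<in>X. (\<Sum>i\<in>I. ((Q ^^ t) (V i) x)\<^sup>2) / (Q ^^ t) u x"])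
  show "(\<Sum>x\<in>X. \<Sum>j\<in>I. slope (\<lambda>i. (Q ^^ t) (V i)) ((Q ^^ t) u) j x) / N
    \<le> 4 * ((\<Sum>x\<in>X. (\<Sum>i\<in>I. ((Q ^^ t) (V i) x)\<^sup>2) / (Q ^^ t) u x)
      - (\<Sum>x\<in>X. (\<Sum>i\<in>I. ((Q ^^ Suc t) (V i) x)\<^sup>2) / (Q ^^ Suc t) u x))" for t
    using quotient_dissipation[of "(Q ^^ t) u" "\<lambda>i. (Q ^^ t) (V i)"] Qpow_pos[OF u] by simp
  show "0 \<le> (\<Sum>x\<in>X. (\<Sum>i\<in>I. ((Q ^^ t) (V i) x)\<^sup>2) / (Q ^^ t) u x)" for t
    using Qpow_pos[OF u] by (intro sum_nonneg divide_nonneg_pos) auto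
  have "(\<Sum>i\<in>I. (V i x)\<^sup>2) / u x \<le> L2_set (\<lambda>i. V i x) I" for x
  proof -
    let ?L = "L2_set (\<lambda>i. V i x) I"
    have "(\<Sum>i\<in>I. (V i x)\<^sup>2) = ?L * ?L"
      by (simp add: L2_set_def sum_nonneg flip: power2_eq_square)
    also have "\<dots> \<le> ?L * u x" using V by (intro mult_left_mono) auto
    finally show ?thesis using u[of x] by (simp add: field_simps)
  qed
  then show "(\<Sum>x\<in>X. (\<Sum>i\<in>I. ((Q ^^ 0) (V i) x)\<^sup>2) / (Q ^^ 0) u x) \<le> (\<Sum>x\<in>X. L2_set (\<lambda>i. V i x) I)"
    by (simp add: sum_mono)
qed

end

section \<open>Weighted energy of the dual field\<close>

context involution_walk begin

definition grad_energy :: "('i \<Rightarrow> 'a \<Rightarrow> real) \<Rightarrow> 'a \<Rightarrow> real" where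
  "grad_energy k x = (\<Sum>j\<in>I. \<Sum>i\<in>I. (D i (k j) x)\<^sup>2)"

definition normsq :: "('i \<Rightarrow> 'a \<Rightarrow> real) \<Rightarrow> 'a \<Rightarrow> real" where
  "normsq k x = (\<Sum>j\<in>I. (k j x)\<^sup>2)"

text \<open>The energy of the dual field \<open>k\<close>, weighted by the same \<open>u\<close> that divides the energy of \<open>V\<close>, so that
  the product of the two energies is free of \<open>u\<close>.\<close>

definition weighted_grad :: "real \<Rightarrow> ('a \<Rightarrow> real) \<Rightarrow> ('i \<Rightarrow> 'a \<Rightarrow> real) \<Rightarrow> real" where
  "weighted_grad M u k = (\<Sum>x\<in>X. min (u x) M * grad_energy k x) / N"

lemma grad_energy_nonneg: "0 \<le> grad_energy k x"
  by (simp add: grad_energy_def sum_nonneg)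

lemma normsq_nonneg: "0 \<le> normsq k x"
  by (simp add: normsq_def sum_nonneg)

lemma normsq_le_iff: "L2_set (\<lambda>j. k j x) I \<le> b \<Longrightarrow> normsq k x \<le> b\<^sup>2"
proof -
  assume "L2_set (\<lambda>j. k j x) I \<le> b"
  then have "(L2_set (\<lambda>j. k j x) I)\<^sup>2 \<le> b\<^sup>2" by (intro power_mono) auto
  then show ?thesis by (simp add: L2_set_def normsq_def sum_nonneg)
qed

lemma L2_set_normsq: "L2_set (\<lambda>j. k j x) I = sqrt (normsq k x)"
  by (simp add: L2_set_def normsq_def)

lemma normsq_Q_le:
  assumes "\<And>y. normsq k y \<le> b\<^sup>2" "0 \<le> b" shows "normsq (\<lambda>j. Q (k j)) x \<le> b\<^sup>2"
proof (rule normsq_le_iff)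
  have "L2_set (\<lambda>j. k j y) I \<le> b" for y
    using real_sqrt_le_mono[OF assms(1)[of y]] assms(2) by (simp add: L2_set_normsq)
  then show "L2_set (\<lambda>j. Q (k j) x) I \<le> b"
    using Q_norm_le[of k "\<lambda>y. b" x] by simp
qed

lemma normsq_Qpow_le:
  assumes "\<And>y. normsq k y \<le> b\<^sup>2" "0 \<le> b" shows "normsq (\<lambda>j. (Q ^^ t) (k j)) x \<le> b\<^sup>2"
  using assms by (induction t arbitrary: x) (auto intro!: normsq_Q_le)

lemma Q_variance: "(\<Sum>i\<in>I. (D i g x)\<^sup>2) / N \<le> Q (\<lambda>y. (g y)\<^sup>2) x - (Q g x)\<^sup>2"
proof -
  let ?L = "Lap g x" and ?S = "\<Sum>i\<in>I. (D i g x)\<^sup>2"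
  have "Lap (\<lambda>y. (g y)\<^sup>2) x = (\<Sum>i\<in>I. 2 * g x * D i g x - 2 * (D i g x)\<^sup>2)"
    unfolding Lap_def by (intro sum.cong refl) (simp add: D_def power2_eq_square field_simps)
  also have "\<dots> = 2 * g x * ?L - 2 * ?S"
    by (simp add: Lap_def sum_subtractf sum_distrib_left)
  finally have L: "Lap (\<lambda>y. (g y)\<^sup>2) x = 2 * g x * ?L - 2 * ?S" .
  have "?L\<^sup>2 \<le> N * ?S"
    using Cauchy_Schwarz_ineq_sum[of "\<lambda>i. 1" "\<lambda>i. D i g x" I] by (simp add: Lap_def)
  then have "?L\<^sup>2 / N\<^sup>2 \<le> ?S / N"
    using N_pos by (simp add: power2_eq_square field_simps)
  moreover have "Q (\<lambda>y. (g y)\<^sup>2) x - (Q g x)\<^sup>2 = 2 * ?S / N - ?L\<^sup>2 / N\<^sup>2"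
    using N_pos by (simp add: Q_Lap L power2_diff power_divide diff_divide_distrib)
  ultimately show ?thesis by linarith
qed

lemma grad_le_variance: "grad_energy k x / N \<le> Q (normsq k) x - normsq (\<lambda>j. Q (k j)) x"
proof -
  have "grad_energy k x / N = (\<Sum>j\<in>I. (\<Sum>i\<in>I. (D i (k j) x)\<^sup>2) / N)"
    by (simp add: grad_energy_def sum_divide_distrib)
  also have "\<dots> \<le> (\<Sum>j\<in>I. Q (\<lambda>y. (k j y)\<^sup>2) x - (Q (k j) x)\<^sup>2)"
    by (intro sum_mono Q_variance)
  finally show ?thesis
    by (simp add: normsq_def[abs_def] Q_sum sum_subtractf)
qed

lemma sum_normsq_Q: "(\<Sum>x\<in>X. normsq (\<lambda>j. Q (k j)) x) \<le> (\<Sum>x\<in>X. normsq k x)"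
proof -
  have "normsq (\<lambda>j. Q (k j)) x \<le> Q (normsq k) x" for x
    using grad_le_variance[of k x] grad_energy_nonneg[of k x] N_pos
    by (smt (verit) divide_nonneg_pos)
  then show ?thesis
    by (metis sum_Q sum_mono)
qed

lemma sum_normsq_Qpow: "(\<Sum>x\<in>X. normsq (\<lambda>j. (Q ^^ t) (k j)) x) \<le> (\<Sum>x\<in>X. normsq k x)"
proof (induction t)
  case (Suc t)
  then show ?case
    using sum_normsq_Q[of "\<lambda>j. (Q ^^ t) (k j)"] by simp
qed simp

lemma Lap_form: "(\<Sum>x\<in>X. Lap g x * h x) = (\<Sum>x\<in>X. \<Sum>i\<in>I. D i g x * D i h x)"
proof -
  have idem: "D i (D i h) = D i h" for i
    by (rule ext) (simp add: D_def field_simps)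
  have "(\<Sum>x\<in>X. Lap g x * h x) = (\<Sum>i\<in>I. \<Sum>x\<in>X. g x * D i h x)"
    by (simp add: Lap_parts) (simp add: Lap_def sum_distrib_left sum.swap[of _ X I])
  also have "\<dots> = (\<Sum>i\<in>I. \<Sum>x\<in>X. D i g x * D i h x)"
  proof (rule sum.cong[OF refl])
    fix i assume "i \<in> I"
    then show "(\<Sum>x\<in>X. g x * D i h x) = (\<Sum>x\<in>X. D i g x * D i h x)"
      using D_parts[of i g "D i h"] by (simp add: idem)
  qed
  finally show ?thesis by (simp add: sum.swap[of _ X I])
qed

lemma Q_min_le: "Q (\<lambda>y. min (u y) M) x \<le> min (Q u x) M"
  using Q_mono[of "\<lambda>y. min (u y) M" u x] Q_mono[of "\<lambda>y. min (u y) M" "\<lambda>y. M" x] by simp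

lemma min_Q_half:
  assumes "0 \<le> M" "\<And>y. 0 \<le> u y" shows "min (u x) M \<le> 2 * min (Q u x) M"
  using Q_ge_half[of u x] assms by (auto simp: min_def)

text \<open>The increment of \<open>|k|\<^sup>2\<close> is at most \<open>4\<close> times the increment of \<open>k\<close> because \<open>|k| \<le> 2\<close>, and the squared
  increment of the capped weight is at most its larger end times its Hellinger energy. The constants
  \<open>32\<close> and \<open>1 / 8\<close> split the product so that the second term can be absorbed in
  \<open>weighted_grad_step\<close>.\<close>

lemma D_min_normsq:
  assumes u: "\<And>y. 0 \<le> u y" and M: "0 \<le> M" and k: "\<And>y. normsq k y \<le> 4"
  shows "\<bar>D i (\<lambda>y. min (u y) M) x * D i (normsq k) x\<bar>
    \<le> 32 * hellinger M u i x
      + (min (u x) M + min (u (\<sigma> i x)) M) * (\<Sum>j\<in>I. (D i (k j) x)\<^sup>2) / 8"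
proof -
  let ?s = "min (u x) M" and ?r = "min (u (\<sigma> i x)) M"
  let ?h = "hellinger M u i x" and ?G = "\<Sum>j\<in>I. (D i (k j) x)\<^sup>2"
  have sr: "0 \<le> ?s" "0 \<le> ?r" using u M by auto
  have "D i (normsq k) x = (\<Sum>j\<in>I. D i (k j) x * (k j x + k j (\<sigma> i x)))"
    by (simp add: D_def normsq_def sum_subtractf[symmetric] sum_divide_distrib power2_eq_square field_simps)
  then have "(D i (normsq k) x)\<^sup>2 \<le> ?G * (\<Sum>j\<in>I. (k j x + k j (\<sigma> i x))\<^sup>2)"
    using Cauchy_Schwarz_ineq_sum[of "\<lambda>j. D i (k j) x" "\<lambda>j. k j x + k j (\<sigma> i x)" I] by simp
  also have "(\<Sum>j\<in>I. (k j x + k j (\<sigma> i x))\<^sup>2) \<le> (\<Sum>j\<in>I. 2 * (k j x)\<^sup>2 + 2 * (k j (\<sigma> i x))\<^sup>2)"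
  proof (rule sum_mono)
    fix j show "(k j x + k j (\<sigma> i x))\<^sup>2 \<le> 2 * (k j x)\<^sup>2 + 2 * (k j (\<sigma> i x))\<^sup>2"
      using zero_le_power2[of "k j x - k j (\<sigma> i x)"] by (simp only: power2_sum power2_diff)
  qed
  also have "\<dots> = 2 * normsq k x + 2 * normsq k (\<sigma> i x)"
    by (simp add: normsq_def sum.distrib sum_distrib_left)
  also have "\<dots> \<le> 16" using k[of x] k[of "\<sigma> i x"] by simp
  finally have B: "(D i (normsq k) x)\<^sup>2 \<le> 16 * ?G"
    by (simp add: mult_left_mono sum_nonneg mult.commute[of 16])
  have "(D i (\<lambda>y. min (u y) M) x)\<^sup>2 = (?s - ?r)\<^sup>2 / 4"
    by (simp add: D_def power_divide)
  also have "\<dots> \<le> max ?s ?r * ?h"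
    using sq_diff_le_sqrt[OF sr] by (simp add: hellinger_def)
  also have "\<dots> \<le> (?s + ?r) * ?h"
    using sr by (intro mult_right_mono) auto
  finally have A: "(D i (\<lambda>y. min (u y) M) x)\<^sup>2 \<le> (?s + ?r) * ?h" .
  let ?p = "32 * ?h" and ?q = "(?s + ?r) * ?G / 8"
  have pq: "0 \<le> ?p" "0 \<le> ?q" using sr by (auto intro!: mult_nonneg_nonneg sum_nonneg divide_nonneg_pos)
  have "\<bar>D i (\<lambda>y. min (u y) M) x * D i (normsq k) x\<bar>\<^sup>2
      = (D i (\<lambda>y. min (u y) M) x)\<^sup>2 * (D i (normsq k) x)\<^sup>2"
    by (simp add: power_mult_distrib)
  also have "\<dots> \<le> ((?s + ?r) * ?h) * (16 * ?G)"
    using A B sr by (intro mult_mono) (auto intro!: mult_nonneg_nonneg)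
  also have "\<dots> = 4 * ?p * ?q" by (simp add: algebra_simps)
  also have "\<dots> \<le> (?p + ?q)\<^sup>2"
    using zero_le_power2[of "?p - ?q"] unfolding power2_sum power2_diff by linarith
  finally show ?thesis
    by (rule power2_le_imp_le) (intro add_nonneg_nonneg pq)
qed

lemma weighted_grad_nonneg: "(\<And>y. 0 \<le> u y) \<Longrightarrow> 0 \<le> M \<Longrightarrow> 0 \<le> weighted_grad M u k"
  unfolding weighted_grad_def using N_pos
  by (intro divide_nonneg_pos sum_nonneg mult_nonneg_nonneg grad_energy_nonneg) auto

lemma sum_weight_dir:
  "(\<Sum>x\<in>X. \<Sum>i\<in>I. (w x + w (\<sigma> i x)) * (\<Sum>j\<in>I. (D i (k j) x)\<^sup>2))
    = 2 * (\<Sum>x\<in>X. w x * grad_energy k x)"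
proof -
  have "grad_energy k x = (\<Sum>i\<in>I. \<Sum>j\<in>I. (D i (k j) x)\<^sup>2)" for x
    unfolding grad_energy_def by (rule sum.swap)
  then show ?thesis
    using sum_sym_weight[of "\<lambda>i x. \<Sum>j\<in>I. (D i (k j) x)\<^sup>2" w] by (simp add: D_sq)
qed

text \<open>The natural monotone quantity is the sum of \<open>\<omega> |k|\<^sup>2\<close> with \<open>\<omega> = min u M\<close>: averaging \<open>k\<close> releases its
  energy (\<open>grad_le_variance\<close>). Two errors arise because the weight evolves as well. The cap is concave, so
  \<open>\<omega>' - Q \<omega>\<close> is nonnegative and its contribution telescopes; the remaining drift \<open>Q \<omega> - \<omega>\<close> pairs the
  increments of \<open>\<omega>\<close> with those of \<open>|k|\<^sup>2\<close> and is absorbed at the price of the Hellinger energy. One of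
  these pairings is with the field at the next time, whence the last term.\<close>

lemma weighted_grad_step:
  assumes u: "\<And>y. 0 \<le> u y" and M: "0 \<le> M" and k: "\<And>y. normsq k y \<le> 4"
  defines "\<omega> \<equiv> \<lambda>y. min (u y) M" and "\<omega>' \<equiv> \<lambda>y. min (Q u y) M" and "k' \<equiv> \<lambda>j. Q (k j)"
  shows "weighted_grad M u k \<le>
    (\<Sum>x\<in>X. \<omega> x * normsq k x) - (\<Sum>x\<in>X. \<omega>' x * normsq k' x)
    + 4 * ((\<Sum>x\<in>X. \<omega>' x) - (\<Sum>x\<in>X. \<omega> x))
    + 64 * ((\<Sum>x\<in>X. \<Sum>i\<in>I. hellinger M u i x) / N)
    + weighted_grad M u k / 4 + weighted_grad M (Q u) k' / 2"
proof -
  let ?H = "(\<Sum>x\<in>X. \<Sum>i\<in>I. hellinger M u i x) / N"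
  have \<omega>0: "0 \<le> \<omega> y" for y using u M by (simp add: \<omega>_def)
  have k': "normsq k' y \<le> 4" for y
    using normsq_Q_le[of k 2 y] k by (simp add: k'_def)
  have "weighted_grad M u k = (\<Sum>x\<in>X. \<omega> x * (grad_energy k x / N))"
    by (simp add: weighted_grad_def \<omega>_def sum_divide_distrib)
  also have "\<dots> \<le> (\<Sum>x\<in>X. \<omega> x * (Q (normsq k) x - normsq k' x))"
    unfolding k'_def by (intro sum_mono mult_left_mono grad_le_variance \<omega>0)
  also have "\<dots> = (\<Sum>x\<in>X. Q \<omega> x * normsq k x) - (\<Sum>x\<in>X. \<omega> x * normsq k' x)"
    by (simp add: right_diff_distrib sum_subtractf Q_parts)
  also have "\<dots> = (\<Sum>x\<in>X. \<omega> x * normsq k x) - (\<Sum>x\<in>X. \<omega>' x * normsq k' x)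
      + (\<Sum>x\<in>X. (\<omega>' x - Q \<omega> x) * normsq k' x)
      + (\<Sum>x\<in>X. (Q \<omega> x - \<omega> x) * normsq k x) + (\<Sum>x\<in>X. (Q \<omega> x - \<omega> x) * normsq k' x)"
    by (simp add: left_diff_distrib sum_subtractf)
  finally have main: "weighted_grad M u k \<le> (\<Sum>x\<in>X. \<omega> x * normsq k x) - (\<Sum>x\<in>X. \<omega>' x * normsq k' x)
      + (\<Sum>x\<in>X. (\<omega>' x - Q \<omega> x) * normsq k' x)
      + (\<Sum>x\<in>X. (Q \<omega> x - \<omega> x) * normsq k x) + (\<Sum>x\<in>X. (Q \<omega> x - \<omega> x) * normsq k' x)" .
  have "(\<Sum>x\<in>X. (\<omega>' x - Q \<omega> x) * normsq k' x) \<le> (\<Sum>x\<in>X. (\<omega>' x - Q \<omega> x) * 4)"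
    using Q_min_le[of u M] k' by (intro sum_mono mult_left_mono) (auto simp: \<omega>_def \<omega>'_def)
  also have "\<dots> = 4 * ((\<Sum>x\<in>X. \<omega>' x) - (\<Sum>x\<in>X. \<omega> x))"
    by (simp add: sum_subtractf sum_Q flip: sum_distrib_right)
  finally have concave: "(\<Sum>x\<in>X. (\<omega>' x - Q \<omega> x) * normsq k' x) \<le> 4 * ((\<Sum>x\<in>X. \<omega>' x) - (\<Sum>x\<in>X. \<omega> x))" .
  have err: "(\<Sum>x\<in>X. (Q \<omega> x - \<omega> x) * normsq \<kappa> x)
      \<le> 32 * ?H + (\<Sum>x\<in>X. \<Sum>i\<in>I. (\<omega> x + \<omega> (\<sigma> i x)) * (\<Sum>j\<in>I. (D i (\<kappa> j) x)\<^sup>2)) / (8 * N)"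
    if \<kappa>: "\<And>y. normsq \<kappa> y \<le> 4" for \<kappa>
  proof -
    have "(\<Sum>x\<in>X. (Q \<omega> x - \<omega> x) * normsq \<kappa> x) = - (\<Sum>x\<in>X. Lap \<omega> x * normsq \<kappa> x) / N"
      by (simp add: Q_Lap sum_negf sum_divide_distrib)
    also have "\<dots> = (\<Sum>x\<in>X. \<Sum>i\<in>I. - (D i \<omega> x * D i (normsq \<kappa>) x)) / N"
      by (simp add: Lap_form sum_negf)
    also have "\<dots> \<le> (\<Sum>x\<in>X. \<Sum>i\<in>I. 32 * hellinger M u i x
        + (\<omega> x + \<omega> (\<sigma> i x)) * (\<Sum>j\<in>I. (D i (\<kappa> j) x)\<^sup>2) / 8) / N"
    proof (intro divide_right_mono sum_mono)
      fix x i
      show "- (D i \<omega> x * D i (normsq \<kappa>) x) \<le> 32 * hellinger M u i x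
        + (\<omega> x + \<omega> (\<sigma> i x)) * (\<Sum>j\<in>I. (D i (\<kappa> j) x)\<^sup>2) / 8"
        using D_min_normsq[of u M \<kappa> i x] u M \<kappa> unfolding \<omega>_def by (smt (verit))
    qed (use N_pos in auto)
    also have "\<dots> = 32 * ?H + (\<Sum>x\<in>X. \<Sum>i\<in>I. (\<omega> x + \<omega> (\<sigma> i x)) * (\<Sum>j\<in>I. (D i (\<kappa> j) x)\<^sup>2)) / (8 * N)"
      by (simp add: sum.distrib add_divide_distrib flip: sum_distrib_left sum_divide_distrib)
    finally show ?thesis .
  qed
  have e1: "(\<Sum>x\<in>X. (Q \<omega> x - \<omega> x) * normsq k x) \<le> 32 * ?H + weighted_grad M u k / 4"
  proof -
    have "weighted_grad M u k = (\<Sum>x\<in>X. \<omega> x * grad_energy k x) / N"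
      by (simp add: weighted_grad_def \<omega>_def)
    then show ?thesis using err[OF k] by (simp add: sum_weight_dir[of \<omega>])
  qed
  have "(\<Sum>x\<in>X. \<Sum>i\<in>I. (\<omega> x + \<omega> (\<sigma> i x)) * (\<Sum>j\<in>I. (D i (k' j) x)\<^sup>2))
      \<le> (\<Sum>x\<in>X. \<Sum>i\<in>I. (2 * \<omega>' x + 2 * \<omega>' (\<sigma> i x)) * (\<Sum>j\<in>I. (D i (k' j) x)\<^sup>2))"
    using min_Q_half[OF M u] unfolding \<omega>_def \<omega>'_def
    by (intro sum_mono mult_right_mono add_mono sum_nonneg) auto
  also have "\<dots> = 4 * (\<Sum>x\<in>X. \<omega>' x * grad_energy k' x)"
    using sum_weight_dir[of "\<lambda>x. 2 * \<omega>' x" k'] by (simp add: sum_distrib_left mult.assoc)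
  finally have "(\<Sum>x\<in>X. \<Sum>i\<in>I. (\<omega> x + \<omega> (\<sigma> i x)) * (\<Sum>j\<in>I. (D i (k' j) x)\<^sup>2)) / (8 * N)
      \<le> 4 * (\<Sum>x\<in>X. \<omega>' x * grad_energy k' x) / (8 * N)"
    using N_pos by (intro divide_right_mono) auto
  with err[OF k'] have e2: "(\<Sum>x\<in>X. (Q \<omega> x - \<omega> x) * normsq k' x) \<le> 32 * ?H + weighted_grad M (Q u) k' / 2"
    by (simp add: weighted_grad_def \<omega>'_def)
  from main concave e1 e2 show ?thesis by linarith
qed

text \<open>Three quarters of the energies are absorbed on the left. Splitting the weight as \<open>(u - 1) + 1\<close>
  separates what \<open>u\<close> has to pay from what the dual field pays for itself; this keeps the second part proportional
  to the \<open>L\<^sup>2\<close> mass of \<open>k\<close> rather than to \<open>card X\<close>.\<close>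

lemma total_weighted_grad:
  assumes u: "\<And>y. 1 \<le> u y" and M: "1 \<le> M" and k: "\<And>y. normsq k y \<le> 4"
  shows "(\<Sum>t<T. weighted_grad M ((Q ^^ t) u) (\<lambda>j. (Q ^^ t) (k j)))
    \<le> (40 + 1024 * ln M) * (\<Sum>x\<in>X. u x - 1) + 6 * (\<Sum>x\<in>X. normsq k x)"
proof -
  define uu where "uu t = (Q ^^ t) u" for t
  define kk where "kk t j = (Q ^^ t) (k j)" for t j
  define \<omega> where "\<omega> t y = min (uu t y) M" for t y
  define F where "F t = weighted_grad M (uu t) (kk t)" for t
  define \<beta> where "\<beta> t = (\<Sum>x\<in>X. \<omega> t x * normsq (kk t) x)" for t
  define W where "W t = (\<Sum>x\<in>X. \<omega> t x)" for t
  define H where "H t = (\<Sum>x\<in>X. \<Sum>i\<in>I. hellinger M (uu t) i x) / N" for t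
  let ?v = "\<Sum>x\<in>X. u x - 1" and ?K = "\<Sum>x\<in>X. normsq k x"
  have uu1: "1 \<le> uu t y" for t y
    using Qpow_ge_1[OF u] by (simp add: uu_def)
  have uu0: "0 \<le> uu t y" for t y
    using uu1[of t y] by linarith
  have \<omega>1: "1 \<le> \<omega> t y" for t y
    using uu1[of t y] M by (simp add: \<omega>_def)
  have kk4: "normsq (kk t) y \<le> 4" for t y
    using normsq_Qpow_le[of k 2 t y] k by (simp add: kk_def[abs_def])
  have sum_uu: "(\<Sum>x\<in>X. uu t x - 1) = ?v" for t
    using sum_Qpow[of t u] by (simp add: uu_def sum_subtractf)
  have v0: "0 \<le> ?v"
    using u by (intro sum_nonneg) auto
  have \<omega>_split: "\<omega> t x * c \<le> 4 * (uu t x - 1) + c" if "0 \<le> c" "c \<le> 4" for t x c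
  proof -
    have "\<omega> t x * c \<le> uu t x * c"
      using that by (intro mult_right_mono) (auto simp: \<omega>_def)
    also have "\<dots> = (uu t x - 1) * c + c" by (simp add: algebra_simps)
    also have "(uu t x - 1) * c \<le> (uu t x - 1) * 4"
      using that uu1[of t x] by (intro mult_left_mono) auto
    finally show ?thesis by simp
  qed
  have step: "F t \<le> \<beta> t - \<beta> (Suc t) + 4 * (W (Suc t) - W t) + 64 * H t + F t / 4 + F (Suc t) / 2" for t
  proof -
    have "uu (Suc t) = Q (uu t)" "kk (Suc t) = (\<lambda>j. Q (kk t j))"
      by (simp_all add: uu_def kk_def fun_eq_iff)
    then show ?thesis
      using weighted_grad_step[of "uu t" M "kk t"] uu0 M kk4
      by (simp add: F_def \<beta>_def W_def H_def \<omega>_def)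
  qed
  have \<beta>0: "\<beta> 0 \<le> 4 * ?v + ?K"
  proof -
    have "\<beta> 0 \<le> (\<Sum>x\<in>X. 4 * (uu 0 x - 1) + normsq (kk 0) x)"
      unfolding \<beta>_def by (intro sum_mono \<omega>_split normsq_nonneg kk4)
    also have "\<dots> = 4 * ?v + ?K"
      by (simp add: sum.distrib uu_def kk_def[abs_def] sum_distrib_left)
    finally show ?thesis .
  qed
  have \<beta>T: "0 \<le> \<beta> T"
    unfolding \<beta>_def using \<omega>1 by (intro sum_nonneg mult_nonneg_nonneg normsq_nonneg) (smt (verit))
  have WT: "W T - W 0 \<le> ?v"
  proof -
    have "W T - W 0 \<le> (\<Sum>x\<in>X. uu T x) - (\<Sum>x\<in>X. 1)"
      unfolding W_def using \<omega>1 by (intro diff_mono sum_mono) (auto simp: \<omega>_def)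
    then show ?thesis using sum_uu[of T] by (simp add: sum_subtractf)
  qed
  \<comment> \<open>The last energy has no later time to be absorbed by, but a single step is bounded trivially.\<close>
  have FT: "F T \<le> 4 * ?v + ?K"
  proof -
    have "F T = (\<Sum>x\<in>X. \<omega> T x * (grad_energy (kk T) x / N))"
      by (simp add: F_def weighted_grad_def \<omega>_def sum_divide_distrib)
    also have "\<dots> \<le> (\<Sum>x\<in>X. \<omega> T x * Q (normsq (kk T)) x)"
    proof (intro sum_mono mult_left_mono)
      fix x
      show "grad_energy (kk T) x / N \<le> Q (normsq (kk T)) x"
        using grad_le_variance[of "kk T" x] normsq_nonneg[of "\<lambda>j. Q (kk T j)" x] by linarith
      show "0 \<le> \<omega> T x" using \<omega>1[of T x] by linarith
    qed
    also have "\<dots> \<le> (\<Sum>x\<in>X. 4 * (uu T x - 1) + Q (normsq (kk T)) x)"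
    proof (intro sum_mono \<omega>_split)
      fix x
      show "0 \<le> Q (normsq (kk T)) x"
        using Q_mono[of "\<lambda>y. 0" "normsq (kk T)" x] normsq_nonneg by simp
      show "Q (normsq (kk T)) x \<le> 4"
        using Q_mono[of "normsq (kk T)" "\<lambda>y. 4" x] kk4 by simp
    qed
    also have "\<dots> = 4 * ?v + (\<Sum>x\<in>X. normsq (kk T) x)"
      by (simp only: sum.distrib sum_uu sum_Q flip: sum_distrib_left)
    also have "(\<Sum>x\<in>X. normsq (kk T) x) \<le> ?K"
      unfolding kk_def by (rule sum_normsq_Qpow)
    finally show ?thesis by simp
  qed
  have F0: "0 \<le> F t" for t
    unfolding F_def using uu0 M by (intro weighted_grad_nonneg) auto
  have HT: "(\<Sum>t<T. H t) \<le> 4 * (ln M * ?v)"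
    unfolding H_def uu_def by (rule total_hellinger[OF u M])
  have "(\<Sum>t<T. F t) \<le> (\<Sum>t<T. (\<beta> t - \<beta> (Suc t)) + 4 * (W (Suc t) - W t) + 64 * H t + F t / 4 + F (Suc t) / 2)"
    using step by (intro sum_mono) simp
  also have "\<dots> = (\<beta> 0 - \<beta> T) + 4 * (W T - W 0) + 64 * (\<Sum>t<T. H t)
      + (\<Sum>t<T. F t) / 4 + (\<Sum>t<T. F (Suc t)) / 2"
    by (simp only: sum.distrib sum_lessThan_telescope' sum_lessThan_telescope
        flip: sum_distrib_left sum_divide_distrib)
  finally have sumF: "(\<Sum>t<T. F t) \<le> (\<beta> 0 - \<beta> T) + 4 * (W T - W 0) + 64 * (\<Sum>t<T. H t)
      + (\<Sum>t<T. F t) / 4 + (\<Sum>t<T. F (Suc t)) / 2" .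
  have shift: "(\<Sum>t<T. F (Suc t)) \<le> (\<Sum>t<T. F t) + F T"
    using F0[of 0] sum.lessThan_Suc_shift[of F T] sum.lessThan_Suc[of F T] by linarith
  have "(\<Sum>t<T. F t) \<le> 4 * ((4 * ?v + ?K) + 4 * ?v + 64 * (4 * (ln M * ?v)) + (4 * ?v + ?K) / 2)"
  proof -
    define S where "S = (\<Sum>t<T. F t)"
    define q where "q = ln M * ?v"
    define v where "v = ?v"
    have "S \<le> \<beta> 0 - \<beta> T + 4 * (W T - W 0) + 64 * (\<Sum>t<T. H t) + S / 4 + (S + F T) / 2"
      using sumF shift[THEN divide_right_mono, of 2] unfolding S_def[symmetric] by linarith
    moreover have "\<beta> 0 \<le> 4 * v + ?K" "F T \<le> 4 * v + ?K" "W T - W 0 \<le> v" "(\<Sum>t<T. H t) \<le> 4 * q"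
      using \<beta>0 WT FT HT by (simp_all add: v_def q_def)
    ultimately have "S \<le> 4 * ((4 * v + ?K) + 4 * v + 64 * (4 * q) + (4 * v + ?K) / 2)"
      using \<beta>T by argo
    then show ?thesis by (simp only: S_def q_def v_def)
  qed
  then show ?thesis
    by (simp add: F_def uu_def kk_def[abs_def] algebra_simps add_divide_distrib)
qed

end

section \<open>Truncation at high levels\<close>

definition cutoff :: "real \<Rightarrow> real \<Rightarrow> real" where
  "cutoff K z = max 0 (min 1 ((2 * K - z) / K))"

lemma cutoff_range: "0 \<le> cutoff K z" "cutoff K z \<le> 1"
  by (auto simp: cutoff_def)

lemma cutoff_low: "0 < K \<Longrightarrow> z \<le> K \<Longrightarrow> cutoff K z = 1"
  by (auto simp: cutoff_def field_simps)

lemma cutoff_high: "0 < K \<Longrightarrow> 2 * K \<le> z \<Longrightarrow> cutoff K z = 0"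
  by (auto simp: cutoff_def field_simps)

lemma cutoff_min: "0 < K \<Longrightarrow> 2 * K \<le> M \<Longrightarrow> cutoff K (min z M) = cutoff K z"
  by (cases "z \<le> M") (simp_all add: cutoff_high)

lemma cutoff_lipschitz:
  assumes "0 < K" shows "\<bar>cutoff K s - cutoff K r\<bar> \<le> \<bar>s - r\<bar> / K"
proof -
  have "(2 * K - s) / K - (2 * K - r) / K = (r - s) / K"
    by (simp add: diff_divide_distrib)
  then have "\<bar>(2 * K - s) / K - (2 * K - r) / K\<bar> = \<bar>s - r\<bar> / K"
    using assms by (simp add: abs_minus_commute)
  then show ?thesis unfolding cutoff_def by linarith
qed

text \<open>If both ends are comparable to \<open>K\<close>, the cutoff is Lipschitz with constant \<open>1 / K\<close> and the Hellinger term
  sees the same increment. If one end is above \<open>4 K\<close>, the other must be below \<open>2 K\<close> for the cutoff to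
  change, and then the Hellinger term is itself comparable to the larger end.\<close>

lemma cutoff_jump:
  assumes K: "0 < K" and s: "0 \<le> s" and r: "0 \<le> r"
  shows "max s r * ((cutoff K s - cutoff K r) / 2)\<^sup>2 \<le> 16 * (sqrt s - sqrt r)\<^sup>2"
proof -
  have main: "s * ((cutoff K s - cutoff K r) / 2)\<^sup>2 \<le> 16 * (sqrt s - sqrt r)\<^sup>2"
    if sr: "r \<le> s" and r: "0 \<le> r" for s r
  proof -
    let ?d = "cutoff K s - cutoff K r" and ?e = "(sqrt s - sqrt r)\<^sup>2"
    have s: "0 \<le> s" using sr r by simp
    show ?thesis
    proof (cases "s \<le> 4 * K")
      case True
      have "?d\<^sup>2 \<le> (\<bar>s - r\<bar> / K)\<^sup>2"
        using cutoff_lipschitz[OF K, of s r] K by (intro abs_le_square_iff[THEN iffD1]) simp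
      also have "\<dots> = (s - r)\<^sup>2 / K\<^sup>2" by (simp add: power_divide)
      also have "\<dots> \<le> 4 * s * ?e / K\<^sup>2"
        using sq_diff_le_sqrt[OF s r] sr by (intro divide_right_mono) (simp_all add: max_absorb1)
      finally have "s * ?d\<^sup>2 \<le> s * (4 * s * ?e / K\<^sup>2)"
        using s by (rule mult_left_mono)
      also have "\<dots> = 4 * (s / K)\<^sup>2 * ?e"
        by (simp add: power2_eq_square)
      also have "\<dots> \<le> 4 * 4\<^sup>2 * ?e"
        using True K s by (intro mult_right_mono mult_left_mono power_mono) (auto simp: field_simps)
      finally show ?thesis by (simp add: power_divide)
    next
      case False
      show ?thesis
      proof (cases "2 * K \<le> r")
        case True
        then show ?thesis using False K by (simp add: cutoff_high)
      next
        case rK: False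
        have d: "?d\<^sup>2 \<le> 1"
          using cutoff_range[of K s] cutoff_range[of K r] by (intro abs_square_le_1[THEN iffD2]) linarith
        have "sqrt r \<le> sqrt ((7 / 8)\<^sup>2 * s)"
          using False rK s K by (intro real_sqrt_le_mono) (simp add: power2_eq_square)
        also have "\<dots> = 7 / 8 * sqrt s" by (simp add: real_sqrt_mult)
        finally have "(sqrt s / 8)\<^sup>2 \<le> ?e"
          using s by (intro power_mono) auto
        then have "s \<le> 64 * ?e" using s by (simp add: power_divide)
        moreover have "s * (?d / 2)\<^sup>2 \<le> s * (1 / 4)"
          using d s by (intro mult_left_mono) (auto simp: power_divide)
        ultimately show ?thesis by simp
      qed
    qed
  qed
  show ?thesis
  proof (cases "r \<le> s")
    case True
    then show ?thesis using main[OF True r] by (simp add: max_absorb1)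
  next
    case False
    then show ?thesis using main[of s r] s
      by (simp add: max_absorb2 power_divide power2_commute[of "sqrt r"] power2_commute[of "cutoff K r"])
  qed
qed

lemma cutoff_jump_level:
  assumes K: "0 < K" and s: "0 \<le> s" and r: "0 \<le> r"
  shows "K * ((cutoff K s - cutoff K r) / 2)\<^sup>2 \<le> 16 * (sqrt s - sqrt r)\<^sup>2"
proof (cases "K \<le> max s r")
  case True
  then have "K * ((cutoff K s - cutoff K r) / 2)\<^sup>2 \<le> max s r * ((cutoff K s - cutoff K r) / 2)\<^sup>2"
    by (intro mult_right_mono) auto
  then show ?thesis using cutoff_jump[OF assms] by linarith
next
  case False
  then show ?thesis using K by (simp add: cutoff_low)
qed

context involution_walk begin

lemma cutoff_hellinger:
  assumes K: "0 < K" and KM: "2 * K \<le> M" and u: "\<And>y. 0 \<le> u y"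
  defines "c \<equiv> \<lambda>y. cutoff K (u y)"
  shows "min (u x) M * (D i c x)\<^sup>2 \<le> 16 * hellinger M u i x"
    and "K * (D i c x)\<^sup>2 \<le> 16 * hellinger M u i x"
proof -
  let ?s = "min (u x) M" and ?r = "min (u (\<sigma> i x)) M"
  have sr: "0 \<le> ?s" "0 \<le> ?r" using u K KM by auto
  have D: "D i c x = (cutoff K ?s - cutoff K ?r) / 2"
    using K KM by (simp add: c_def D_def cutoff_min)
  have "?s * (D i c x)\<^sup>2 \<le> max ?s ?r * (D i c x)\<^sup>2"
    by (intro mult_right_mono) auto
  with cutoff_jump[OF K sr] show "?s * (D i c x)\<^sup>2 \<le> 16 * hellinger M u i x"
    by (simp add: D hellinger_def)
  show "K * (D i c x)\<^sup>2 \<le> 16 * hellinger M u i x"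
    using cutoff_jump_level[OF K sr] by (simp add: D hellinger_def)
qed

text \<open>This is where the divergence equation is used. Moving the difference in direction \<open>i\<close> from \<open>V\<close> to \<open>p\<close>, and
  then the difference in direction \<open>j\<close>, free of charge by antisymmetry, from \<open>p\<close> to \<open>V\<close>, transposes
  the indices: a divergence times a divergence becomes a product of two full gradients, to which Cauchy-Schwarz
  applies without loss of dimension.\<close>

lemma flux_by_parts:
  assumes p: "\<And>j. j \<in> I \<Longrightarrow> antisym_along j (p j)"
    and div: "\<And>x. Lap f x = (\<Sum>i\<in>I. 2 * D i (V i) x)"
  shows "(\<Sum>x\<in>X. \<Sum>j\<in>I. p j x * Lap f x)
    = (\<Sum>x\<in>X. \<Sum>j\<in>I. \<Sum>i\<in>I. 2 * D i (p j) x * D j (V i) x)"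
proof -
  have one: "(\<Sum>x\<in>X. p j x * D i (V i) x) = (\<Sum>x\<in>X. D i (p j) x * D j (V i) x)"
    if i: "i \<in> I" and j: "j \<in> I" for i j
  proof -
    have "(\<Sum>x\<in>X. p j x * D i (V i) x) = (\<Sum>x\<in>X. D i (p j) x * V i x)"
      by (rule D_parts[OF i, symmetric])
    also have "\<dots> = (\<Sum>x\<in>X. D j (D i (p j)) x * V i x)"
      by (simp add: antisym_D_eq[OF antisym_D[OF p[OF j]]])
    also have "\<dots> = (\<Sum>x\<in>X. D i (p j) x * D j (V i) x)"
      by (rule D_parts[OF j])
    finally show ?thesis .
  qed
  have "(\<Sum>x\<in>X. \<Sum>j\<in>I. p j x * Lap f x) = (\<Sum>j\<in>I. \<Sum>i\<in>I. 2 * (\<Sum>x\<in>X. p j x * D i (V i) x))"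
    by (simp add: div sum_distrib_left sum.swap[of _ X] mult.left_commute)
  also have "\<dots> = (\<Sum>j\<in>I. \<Sum>i\<in>I. 2 * (\<Sum>x\<in>X. D i (p j) x * D j (V i) x))"
    using one by (intro sum.cong refl) simp
  also have "\<dots> = (\<Sum>x\<in>X. \<Sum>j\<in>I. \<Sum>i\<in>I. 2 * D i (p j) x * D j (V i) x)"
    by (simp add: sum_distrib_left sum.swap[of _ X] mult.assoc)
  finally show ?thesis .
qed

lemma D_product: "D i (\<lambda>y. a y * b y) x = a x * D i b x + b (\<sigma> i x) * D i a x"
  by (simp add: D_def field_simps)

text \<open>Where \<open>u\<close> is large a field dominated by \<open>u\<close> is out of control, but there the flux can be estimated crudely, as \<open>f\<close> is
  bounded: the set is small by Markov's inequality, and powers of \<open>N\<close> are harmless once \<open>K\<close> is a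
  large multiple of \<open>N\<^sup>2\<close>.\<close>

lemma bad_set_flux:
  assumes K: "2 \<le> K" and u: "\<And>y. 1 \<le> u y" and k: "\<And>x. normsq k x \<le> 4"
    and f: "\<And>x. \<bar>Lap f x\<bar> \<le> N"
  defines "c \<equiv> \<lambda>y. cutoff K (u y)"
  shows "(\<Sum>x\<in>X. \<Sum>j\<in>I. (1 - c x * c (\<sigma> j x)) * k j x * Lap f x)
    \<le> 8 * N\<^sup>2 / K * (\<Sum>x\<in>X. u x - 1)"
proof -
  define b where "b x = (if u x > K then 1 else 0 :: real)" for x
  have k2: "\<bar>k j x\<bar> \<le> 2" if "j \<in> I" for j x
  proof -
    have "(k j x)\<^sup>2 \<le> normsq k x"
      unfolding normsq_def using that finI by (intro member_le_sum) auto
    then have "(k j x)\<^sup>2 \<le> 2\<^sup>2" using k[of x] by simp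
    then show ?thesis by (simp add: abs_le_square_iff[of _ 2, simplified])
  qed
  have pt: "(1 - c x * c (\<sigma> j x)) * k j x * Lap f x \<le> 2 * N * b x + 2 * N * b (\<sigma> j x)"
    if j: "j \<in> I" for j x
  proof (cases "u x \<le> K \<and> u (\<sigma> j x) \<le> K")
    case True
    then have "c x = 1" "c (\<sigma> j x) = 1" using K by (simp_all add: c_def cutoff_low)
    then show ?thesis using N_pos by (simp add: b_def)
  next
    case False
    have a: "0 \<le> c x * c (\<sigma> j x)" "c x * c (\<sigma> j x) \<le> 1"
      using cutoff_range unfolding c_def by (simp_all add: mult_le_one)
    have "(1 - c x * c (\<sigma> j x)) * k j x * Lap f x \<le> \<bar>1 - c x * c (\<sigma> j x)\<bar> * \<bar>k j x\<bar> * \<bar>Lap f x\<bar>"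
      by (metis abs_ge_self abs_mult)
    also have "\<dots> \<le> 1 * 2 * N"
      using a k2[OF j] f by (intro mult_mono) auto
    also have "\<dots> \<le> 2 * N * b x + 2 * N * b (\<sigma> j x)"
      using False N_pos by (auto simp: b_def)
    finally show ?thesis .
  qed
  have bb: "b x \<le> 2 / K * (u x - 1)" for x
    using K u[of x] by (auto simp: b_def field_simps)
  have "(\<Sum>x\<in>X. \<Sum>j\<in>I. (1 - c x * c (\<sigma> j x)) * k j x * Lap f x)
      \<le> (\<Sum>x\<in>X. \<Sum>j\<in>I. 2 * N * b x + 2 * N * b (\<sigma> j x))"
    by (intro sum_mono pt)
  also have "\<dots> = (\<Sum>x\<in>X. \<Sum>j\<in>I. 2 * N * b x) + (\<Sum>x\<in>X. \<Sum>j\<in>I. 2 * N * b (\<sigma> j x))"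
    by (simp only: sum.distrib)
  also have "(\<Sum>x\<in>X. \<Sum>j\<in>I. 2 * N * b (\<sigma> j x)) = (\<Sum>x\<in>X. \<Sum>j\<in>I. 2 * N * b x)"
    by (rule sum_flip_family[where g="\<lambda>j x. 2 * N * b x"])
  also have "(\<Sum>x\<in>X. \<Sum>j\<in>I. 2 * N * b x) + (\<Sum>x\<in>X. \<Sum>j\<in>I. 2 * N * b x) = 4 * N\<^sup>2 * (\<Sum>x\<in>X. b x)"
    by (simp add: sum_distrib_left power2_eq_square mult.assoc flip: sum.distrib)
  also have "\<dots> \<le> 4 * N\<^sup>2 * (\<Sum>x\<in>X. 2 / K * (u x - 1))"
    by (intro mult_left_mono sum_mono bb) auto
  also have "\<dots> = 8 * N\<^sup>2 / K * (\<Sum>x\<in>X. u x - 1)"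
    unfolding sum_distrib_left[symmetric] by simp
  finally show ?thesis .
qed

text \<open>The cutoff is evaluated one step later than \<open>u\<close>. Since \<open>Q u\<close> at a point bounds \<open>u\<close> at all its neighbours up
  to the factor \<open>2 N\<close>, every edge at which the cutoff, or its increment, contributes has \<open>u\<close> below the
  cap at both ends. With the cutoff evaluated at the same time as \<open>u\<close> this would fail next to a
  high peak.\<close>

lemma localised:
  assumes K: "0 < K" and M: "4 * N * K \<le> M" and u: "\<And>y. 0 \<le> u y" and i: "i \<in> I"
  defines "c \<equiv> \<lambda>y. cutoff K (Q u y)"
  assumes ne: "c x * c (\<sigma> j x) \<noteq> 0 \<or> D i (\<lambda>y. c y * c (\<sigma> j y)) x \<noteq> 0"
  shows "u x \<le> M \<and> u (\<sigma> j x) \<le> M"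
proof -
  have low: "Q u y < 2 * K" if "c y \<noteq> 0" for y
    using that cutoff_high[OF K, of "Q u y"] by (force simp: c_def)
  have self: "u y \<le> M" if "c y \<noteq> 0" for y
  proof -
    have "u y \<le> 2 * Q u y" using Q_ge_half[of u y] u by simp
    also have "\<dots> \<le> 4 * K" using low[OF that] by simp
    also have "4 * K \<le> N * (4 * K)" using mult_right_mono[OF N_ge_1, of "4 * K"] K by simp
    also have "\<dots> \<le> M" using M by (simp add: mult.assoc mult.left_commute)
    finally show ?thesis .
  qed
  have nbr: "u (\<sigma> i y) \<le> M" if "c y \<noteq> 0" for y
  proof -
    have "u (\<sigma> i y) \<le> 2 * N * Q u y" using Q_ge_neighbour[of u i y] u i by simp
    also have "\<dots> \<le> 2 * N * (2 * K)" using low[OF that] N_pos by (intro mult_left_mono) auto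
    finally show ?thesis using M by simp
  qed
  show ?thesis
  proof (cases "c x * c (\<sigma> j x) = 0")
    case False
    then show ?thesis using self[of x] self[of "\<sigma> j x"] by simp
  next
    case True
    then have "c (\<sigma> i x) * c (\<sigma> j (\<sigma> i x)) \<noteq> 0" using ne by (auto simp: D_def)
    then show ?thesis
      using nbr[of "\<sigma> i x"] nbr[of "\<sigma> j (\<sigma> i x)"] by (simp add: comm[of i j])
  qed
qed

lemma young:
  fixes a b q :: real
  assumes "0 < q" shows "2 * a * b \<le> q * a\<^sup>2 + b\<^sup>2 / q"
proof -
  have "0 \<le> (q * a - b)\<^sup>2 / q" using assms by simp
  also have "\<dots> = q * a\<^sup>2 + b\<^sup>2 / q - 2 * a * b"
    using assms by (simp add: power2_eq_square field_simps)
  finally show ?thesis by simp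
qed

text \<open>The two terms come from the product rule \<open>D_product\<close> for \<open>a * k\<close>: the increment of \<open>k\<close> is weighed
  with a small constant, to be absorbed at the end, and the increment of the cutoff is left for
  \<open>cutoff_gradient_total\<close>.\<close>

lemma edge_flux:
  assumes K: "0 < K" and M: "4 * N * K \<le> M" and u: "\<And>y. 1 \<le> u y"
    and V: "\<And>y. L2_set (\<lambda>i. V i y) I \<le> u y"
  defines "c \<equiv> \<lambda>y. cutoff K (Q u y)"
  defines "a \<equiv> \<lambda>j y. c y * c (\<sigma> j y)"
  defines "W \<equiv> \<lambda>j x. min (u x) M + min (u (\<sigma> j x)) M"
  shows "(\<Sum>i\<in>I. 2 * D i (\<lambda>y. a j y * k j y) x * D j (V i) x)
    \<le> 193 * edge_energy M V u j x + W j x * (\<Sum>i\<in>I. (D i (k j) x)\<^sup>2) / 192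
      + W j x * (\<Sum>i\<in>I. (k j (\<sigma> i x))\<^sup>2 * (D i (a j) x)\<^sup>2)"
proof -
  let ?E = "edge_energy M V u j x"
  have u0: "0 < u y" "0 \<le> u y" for y using u[of y] by linarith+
  have "0 < 4 * N * K" using N_pos K by simp
  with M have M0: "0 < M" by linarith
  have W0: "0 < W j x" using u0[of x] u0[of "\<sigma> j x"] M0 by (simp add: W_def)
  have E0: "0 \<le> ?E" by (rule edge_energy_nonneg[OF u0(1)])
  show ?thesis
  proof (cases "a j x = 0 \<and> (\<forall>i\<in>I. D i (a j) x = 0)")
    case True
    then have "(\<Sum>i\<in>I. 2 * D i (\<lambda>y. a j y * k j y) x * D j (V i) x) = 0"
      by (simp add: D_product)
    also have "0 \<le> 193 * ?E + W j x * (\<Sum>i\<in>I. (D i (k j) x)\<^sup>2) / 192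
      + W j x * (\<Sum>i\<in>I. (k j (\<sigma> i x))\<^sup>2 * (D i (a j) x)\<^sup>2)"
      using E0 W0 by (auto intro!: add_nonneg_nonneg mult_nonneg_nonneg sum_nonneg)
    finally show ?thesis .
  next
    case False
    then obtain i0 where i0: "i0 \<in> I" "a j x \<noteq> 0 \<or> D i0 (a j) x \<noteq> 0"
      using neI by blast
    have uM: "u x \<le> M" "u (\<sigma> j x) \<le> M"
      using localised[where K=K and M=M and u=u and i=i0 and j=j and x=x, OF K M u0(2) i0(1)] i0(2) unfolding a_def c_def by auto
    have bound: "(\<Sum>i\<in>I. (D j (V i) x)\<^sup>2) \<le> W j x * ?E"
      unfolding W_def by (rule edge_energy_bound[OF u0(1) V uM])
    have a01: "0 \<le> a j x" "a j x \<le> 1"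
      using cutoff_range unfolding a_def c_def by (simp_all add: mult_le_one)
    have pt: "2 * D i (\<lambda>y. a j y * k j y) x * D j (V i) x
        \<le> W j x * (D i (k j) x)\<^sup>2 / 192 + W j x * ((k j (\<sigma> i x))\<^sup>2 * (D i (a j) x)\<^sup>2)
          + 193 * (D j (V i) x)\<^sup>2 / W j x" for i
    proof -
      let ?d = "D j (V i) x" and ?g = "D i (k j) x" and ?b = "k j (\<sigma> i x) * D i (a j) x"
      have "(a j x * ?g)\<^sup>2 \<le> ?g\<^sup>2"
        using a01 by (simp add: power_mult_distrib mult_left_le_one_le power_le_one)
      then have "1 / 192 * W j x * (a j x * ?g)\<^sup>2 \<le> 1 / 192 * W j x * ?g\<^sup>2"
        using W0 by (intro mult_left_mono) auto
      moreover have "2 * (a j x * ?g) * ?d \<le> 1 / 192 * W j x * (a j x * ?g)\<^sup>2 + ?d\<^sup>2 / (1 / 192 * W j x)"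
        by (rule young) (use W0 in auto)
      moreover have "2 * ?b * ?d \<le> 1 * W j x * ?b\<^sup>2 + ?d\<^sup>2 / (1 * W j x)"
        by (rule young) (use W0 in auto)
      moreover have "2 * D i (\<lambda>y. a j y * k j y) x * ?d = 2 * (a j x * ?g) * ?d + 2 * ?b * ?d"
        by (simp add: D_product algebra_simps)
      ultimately show ?thesis by (simp add: power_mult_distrib)
    qed
    have "(\<Sum>i\<in>I. 2 * D i (\<lambda>y. a j y * k j y) x * D j (V i) x)
      \<le> (\<Sum>i\<in>I. W j x * (D i (k j) x)\<^sup>2 / 192 + W j x * ((k j (\<sigma> i x))\<^sup>2 * (D i (a j) x)\<^sup>2)
          + 193 * (D j (V i) x)\<^sup>2 / W j x)"
      by (intro sum_mono pt)
    also have "\<dots> = W j x * (\<Sum>i\<in>I. (D i (k j) x)\<^sup>2) / 192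
      + W j x * (\<Sum>i\<in>I. (k j (\<sigma> i x))\<^sup>2 * (D i (a j) x)\<^sup>2) + 193 * (\<Sum>i\<in>I. (D j (V i) x)\<^sup>2) / W j x"
      by (simp only: sum.distrib flip: sum_distrib_left sum_divide_distrib)
    also have "193 * (\<Sum>i\<in>I. (D j (V i) x)\<^sup>2) / W j x \<le> 193 * ?E"
      using bound W0 by (simp add: field_simps)
    finally show ?thesis by simp
  qed
qed

text \<open>The weight is a sum over the two ends of the edge \<open>j\<close>, and everything else is invariant under the flip \<open>j\<close>
  (the square of \<open>k j\<close> by antisymmetry), so only the weight at \<open>x\<close> needs to be considered. The
  product of two cutoffs changes through either factor. For the factor at \<open>x\<close> itself
  \<open>cutoff_hellinger\<close> applies directly; for the one across the edge the remaining cutoff at \<open>x\<close> bounds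
  the weight by \<open>2 K\<close>, after which the increment may be moved across the edge.\<close>

lemma cutoff_gradient_total:
  assumes K: "0 < K" and KM: "2 * K \<le> M" and u: "\<And>y. 0 \<le> u y"
    and k: "\<And>x. normsq k x \<le> 4" and anti: "\<And>j. j \<in> I \<Longrightarrow> antisym_along j (k j)"
  defines "c \<equiv> \<lambda>y. cutoff K (u y)"
  defines "a \<equiv> \<lambda>j y. c y * c (\<sigma> j y)"
  shows "(\<Sum>x\<in>X. \<Sum>j\<in>I. (min (u x) M + min (u (\<sigma> j x)) M) *
      (\<Sum>i\<in>I. (k j (\<sigma> i x))\<^sup>2 * (D i (a j) x)\<^sup>2))
    \<le> 768 * (\<Sum>x\<in>X. \<Sum>i\<in>I. hellinger M u i x)"
proof -
  let ?h = "hellinger M u"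
  let ?\<omega> = "\<lambda>x. min (u x) M"
  have ksq: "(k j (\<sigma> j x))\<^sup>2 = (k j x)\<^sup>2" if "j \<in> I" for j x
    using anti[OF that] by (simp add: antisym_along_def)
  have a_sym: "a j (\<sigma> j x) = a j x" for j x by (simp add: a_def mult.commute)
  have sym: "(k j (\<sigma> i (\<sigma> j x)))\<^sup>2 * (D i (a j) (\<sigma> j x))\<^sup>2 = (k j (\<sigma> i x))\<^sup>2 * (D i (a j) x)\<^sup>2"
    if "j \<in> I" for i j x
    using ksq[OF that, of "\<sigma> i x"] by (simp add: comm[of i j] D_def a_sym)
  have pt: "?\<omega> x * ((k j (\<sigma> i x))\<^sup>2 * (D i (a j) x)\<^sup>2)
     \<le> (k j (\<sigma> i x))\<^sup>2 * (32 * ?h i x) + (k j (\<sigma> i x))\<^sup>2 * (64 * ?h i (\<sigma> j x))" for i j x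
  proof -
    let ?p = "D i c x * c (\<sigma> i (\<sigma> j x))" and ?q = "c x * D i c (\<sigma> j x)"
    have \<omega>0: "0 \<le> ?\<omega> x" using u K KM by simp
    have c01: "0 \<le> c y" "c y \<le> 1" for y using cutoff_range by (simp_all add: c_def)
    have "D i (a j) x = ?p + ?q"
      by (simp add: a_def D_def comm[of j i] field_simps)
    moreover have "(?p + ?q)\<^sup>2 \<le> 2 * ?p\<^sup>2 + 2 * ?q\<^sup>2"
      using zero_le_power2[of "?p - ?q"] by (simp only: power2_sum power2_diff)
    ultimately have "?\<omega> x * (D i (a j) x)\<^sup>2 \<le> ?\<omega> x * (2 * ?p\<^sup>2 + 2 * ?q\<^sup>2)"
      using \<omega>0 by (simp add: mult_left_mono)
    also have "\<dots> = 2 * (?\<omega> x * ?p\<^sup>2) + 2 * (?\<omega> x * ?q\<^sup>2)"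
      by (simp add: algebra_simps)
    also have "?\<omega> x * ?p\<^sup>2 \<le> 16 * ?h i x"
    proof -
      have "?p\<^sup>2 \<le> (D i c x)\<^sup>2"
        using c01 by (simp add: power_mult_distrib mult_left_le power_le_one)
      then have "?\<omega> x * ?p\<^sup>2 \<le> ?\<omega> x * (D i c x)\<^sup>2" using \<omega>0 by (rule mult_left_mono)
      also have "\<dots> \<le> 16 * ?h i x"
        unfolding c_def by (rule cutoff_hellinger(1)[OF K KM u])
      finally show ?thesis .
    qed
    also have "?\<omega> x * ?q\<^sup>2 \<le> 32 * ?h i (\<sigma> j x)"
    proof -
      have "?\<omega> x * (c x)\<^sup>2 \<le> 2 * K"
      proof (cases "u x \<le> 2 * K")
        case True
        have "?\<omega> x * (c x)\<^sup>2 \<le> ?\<omega> x * 1"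
          using c01[of x] \<omega>0 by (intro mult_left_mono) (auto simp: power_le_one)
        then show ?thesis using True by simp
      next
        case False
        then show ?thesis using K by (simp add: c_def cutoff_high)
      qed
      then have "?\<omega> x * (c x)\<^sup>2 * (D i c (\<sigma> j x))\<^sup>2 \<le> 2 * K * (D i c (\<sigma> j x))\<^sup>2"
        by (intro mult_right_mono) auto
      also have "\<dots> \<le> 2 * (16 * ?h i (\<sigma> j x))"
        using cutoff_hellinger(2)[where K=K and M=M and u=u and i=i and x="\<sigma> j x", OF K KM u] unfolding c_def by simp
      finally show ?thesis by (simp add: power_mult_distrib mult.assoc)
    qed
    finally have "?\<omega> x * (D i (a j) x)\<^sup>2 \<le> 32 * ?h i x + 64 * ?h i (\<sigma> j x)"
      by simp
    then have "(k j (\<sigma> i x))\<^sup>2 * (?\<omega> x * (D i (a j) x)\<^sup>2)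
        \<le> (k j (\<sigma> i x))\<^sup>2 * (32 * ?h i x + 64 * ?h i (\<sigma> j x))"
      by (rule mult_left_mono) simp
    then show ?thesis by (simp add: algebra_simps)
  qed
  have shift: "(\<Sum>x\<in>X. \<Sum>j\<in>I. \<Sum>i\<in>I. (k j (\<sigma> i x))\<^sup>2 * ?h i (\<sigma> j x))
      = (\<Sum>x\<in>X. \<Sum>j\<in>I. \<Sum>i\<in>I. (k j (\<sigma> i x))\<^sup>2 * ?h i x)"
  proof -
    have "(\<Sum>x\<in>X. \<Sum>j\<in>I. \<Sum>i\<in>I. (k j (\<sigma> i x))\<^sup>2 * ?h i (\<sigma> j x))
       = (\<Sum>x\<in>X. \<Sum>j\<in>I. \<Sum>i\<in>I. (k j (\<sigma> i (\<sigma> j x)))\<^sup>2 * ?h i (\<sigma> j x))"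
    proof (intro sum.cong refl)
      fix x j i assume "j \<in> I"
      then show "(k j (\<sigma> i x))\<^sup>2 * ?h i (\<sigma> j x) = (k j (\<sigma> i (\<sigma> j x)))\<^sup>2 * ?h i (\<sigma> j x)"
        using ksq[of j "\<sigma> i x"] by (simp add: comm[of i j])
    qed
    also have "\<dots> = (\<Sum>x\<in>X. \<Sum>j\<in>I. \<Sum>i\<in>I. (k j (\<sigma> i x))\<^sup>2 * ?h i x)"
      by (rule sum_flip_family[where g="\<lambda>j x. \<Sum>i\<in>I. (k j (\<sigma> i x))\<^sup>2 * ?h i x"])
    finally show ?thesis .
  qed
  have base: "(\<Sum>x\<in>X. \<Sum>j\<in>I. \<Sum>i\<in>I. (k j (\<sigma> i x))\<^sup>2 * ?h i x) \<le> 4 * (\<Sum>x\<in>X. \<Sum>i\<in>I. ?h i x)"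
  proof -
    have "(\<Sum>j\<in>I. \<Sum>i\<in>I. (k j (\<sigma> i x))\<^sup>2 * ?h i x) = (\<Sum>i\<in>I. normsq k (\<sigma> i x) * ?h i x)" for x
      by (simp add: normsq_def sum_distrib_right) (rule sum.swap)
    then have "(\<Sum>x\<in>X. \<Sum>j\<in>I. \<Sum>i\<in>I. (k j (\<sigma> i x))\<^sup>2 * ?h i x)
        = (\<Sum>x\<in>X. \<Sum>i\<in>I. normsq k (\<sigma> i x) * ?h i x)" by simp
    also have "\<dots> \<le> (\<Sum>x\<in>X. \<Sum>i\<in>I. 4 * ?h i x)"
      by (intro sum_mono mult_right_mono k) auto
    finally show ?thesis by (simp add: sum_distrib_left)
  qed
  have "(\<Sum>x\<in>X. \<Sum>j\<in>I. (?\<omega> x + ?\<omega> (\<sigma> j x)) * (\<Sum>i\<in>I. (k j (\<sigma> i x))\<^sup>2 * (D i (a j) x)\<^sup>2))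
      = 2 * (\<Sum>x\<in>X. ?\<omega> x * (\<Sum>j\<in>I. \<Sum>i\<in>I. (k j (\<sigma> i x))\<^sup>2 * (D i (a j) x)\<^sup>2))"
    by (rule sum_sym_weight) (simp add: sym)
  also have "(\<Sum>x\<in>X. ?\<omega> x * (\<Sum>j\<in>I. \<Sum>i\<in>I. (k j (\<sigma> i x))\<^sup>2 * (D i (a j) x)\<^sup>2))
      \<le> (\<Sum>x\<in>X. \<Sum>j\<in>I. \<Sum>i\<in>I. (k j (\<sigma> i x))\<^sup>2 * (32 * ?h i x) + (k j (\<sigma> i x))\<^sup>2 * (64 * ?h i (\<sigma> j x)))"
    unfolding sum_distrib_left by (intro sum_mono pt)
  also have "\<dots> = 32 * (\<Sum>x\<in>X. \<Sum>j\<in>I. \<Sum>i\<in>I. (k j (\<sigma> i x))\<^sup>2 * ?h i x)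
      + 64 * (\<Sum>x\<in>X. \<Sum>j\<in>I. \<Sum>i\<in>I. (k j (\<sigma> i x))\<^sup>2 * ?h i (\<sigma> j x))"
    by (simp only: sum.distrib mult.left_commute flip: sum_distrib_left)
  also have "\<dots> \<le> 384 * (\<Sum>x\<in>X. \<Sum>i\<in>I. ?h i x)"
    using shift base by simp
  finally show ?thesis by simp
qed

text \<open>Multiplying by the edge-symmetric cutoff \<open>c x * c (\<sigma> j x)\<close> preserves antisymmetry, so the
  truncated part can be integrated by parts, and the rest lives on the bad set. Passing from the
  weight at the present time to the one at the time of the cutoff costs a factor \<open>2\<close>.\<close>

lemma flux_step:
  assumes K: "2 \<le> K" and M: "4 * N * K \<le> M" and u: "\<And>y. 1 \<le> u y"
    and V: "\<And>y. L2_set (\<lambda>i. V i y) I \<le> u y"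
    and k: "\<And>x. normsq k x \<le> 4" and anti: "\<And>j. j \<in> I \<Longrightarrow> antisym_along j (k j)"
    and f: "\<And>x. \<bar>Lap f x\<bar> \<le> N"
    and div: "\<And>x. Lap f x = (\<Sum>i\<in>I. 2 * D i (V i) x)"
  shows "(\<Sum>x\<in>X. Lap f x * (\<Sum>j\<in>I. k j x)) / N
    \<le> 8 * N / K * (\<Sum>x\<in>X. u x - 1)
      + 193 * ((\<Sum>x\<in>X. \<Sum>j\<in>I. edge_energy M V u j x) / N)
      + weighted_grad M u k / 96
      + 1536 * ((\<Sum>x\<in>X. \<Sum>i\<in>I. hellinger M (Q u) i x) / N)"
proof -
  define c where "c y = cutoff K (Q u y)" for y
  define a where "a j y = c y * c (\<sigma> j y)" for j y
  let ?W = "\<lambda>j x. min (u x) M + min (u (\<sigma> j x)) M"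
  let ?W' = "\<lambda>j x. min (Q u x) M + min (Q u (\<sigma> j x)) M"
  let ?B = "\<lambda>j x. \<Sum>i\<in>I. (k j (\<sigma> i x))\<^sup>2 * (D i (a j) x)\<^sup>2"
  have K0: "0 < K" using K by simp
  have u0: "0 \<le> u y" for y using u[of y] by linarith
  have Qu1: "1 \<le> Q u y" for y using Qpow_ge_1[OF u, of 1] by simp
  have Qu0: "0 \<le> Q u y" for y using Qu1[of y] by linarith
  have "4 * K \<le> 4 * N * K" using mult_right_mono[OF N_ge_1, of "4 * K"] K0 by (simp add: mult.assoc mult.left_commute)
  then have KM: "2 * K \<le> M" and M0: "0 \<le> M" using M K0 by linarith+
  have "(\<Sum>x\<in>X. Lap f x * (\<Sum>j\<in>I. k j x)) =
      (\<Sum>x\<in>X. \<Sum>j\<in>I. (1 - c x * c (\<sigma> j x)) * k j x * Lap f x)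
      + (\<Sum>x\<in>X. \<Sum>j\<in>I. (a j x * k j x) * Lap f x)"
    by (simp add: a_def sum_distrib_left algebra_simps flip: sum.distrib)
  also have "(\<Sum>x\<in>X. \<Sum>j\<in>I. (1 - c x * c (\<sigma> j x)) * k j x * Lap f x) \<le> 8 * N\<^sup>2 / K * (\<Sum>x\<in>X. Q u x - 1)"
    unfolding c_def by (rule bad_set_flux[OF K Qu1 k f])
  also have "(\<Sum>x\<in>X. Q u x - 1) = (\<Sum>x\<in>X. u x - 1)"
    by (simp add: sum_subtractf sum_Q)
  also have "(\<Sum>x\<in>X. \<Sum>j\<in>I. (a j x * k j x) * Lap f x)
      = (\<Sum>x\<in>X. \<Sum>j\<in>I. \<Sum>i\<in>I. 2 * D i (\<lambda>y. a j y * k j y) x * D j (V i) x)"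
  proof (rule flux_by_parts[OF _ div])
    fix j assume "j \<in> I"
    then show "antisym_along j (\<lambda>y. a j y * k j y)"
      using anti by (simp add: antisym_along_def a_def mult.commute)
  qed
  also have "\<dots> \<le> (\<Sum>x\<in>X. \<Sum>j\<in>I. 193 * edge_energy M V u j x
      + ?W j x * (\<Sum>i\<in>I. (D i (k j) x)\<^sup>2) / 192 + ?W j x * ?B j x)"
    unfolding a_def c_def by (intro sum_mono edge_flux[OF K0 M u V])
  also have "\<dots> = 193 * (\<Sum>x\<in>X. \<Sum>j\<in>I. edge_energy M V u j x)
      + (\<Sum>x\<in>X. \<Sum>j\<in>I. ?W j x * (\<Sum>i\<in>I. (D i (k j) x)\<^sup>2)) / 192 + (\<Sum>x\<in>X. \<Sum>j\<in>I. ?W j x * ?B j x)"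
    by (simp only: sum.distrib flip: sum_distrib_left sum_divide_distrib)
  also have "(\<Sum>x\<in>X. \<Sum>j\<in>I. ?W j x * (\<Sum>i\<in>I. (D i (k j) x)\<^sup>2)) = 2 * (\<Sum>x\<in>X. min (u x) M * grad_energy k x)"
    unfolding grad_energy_def
  proof (rule sum_sym_weight)
    fix j x assume "j \<in> I"
    then show "(\<Sum>i\<in>I. (D i (k j) (\<sigma> j x))\<^sup>2) = (\<Sum>i\<in>I. (D i (k j) x)\<^sup>2)"
      using antisym_D[OF anti, of j] by (simp add: antisym_along_def)
  qed
  also have "(\<Sum>x\<in>X. \<Sum>j\<in>I. ?W j x * ?B j x) \<le> (\<Sum>x\<in>X. \<Sum>j\<in>I. 2 * (?W' j x * ?B j x))"
  proof (intro sum_mono)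
    fix x j
    have "?W j x \<le> 2 * ?W' j x"
      using min_Q_half[of M u x, OF M0 u0] min_Q_half[of M u "\<sigma> j x", OF M0 u0] by simp
    then have "?W j x * ?B j x \<le> 2 * ?W' j x * ?B j x"
      by (intro mult_right_mono sum_nonneg) auto
    then show "?W j x * ?B j x \<le> 2 * (?W' j x * ?B j x)" by (simp only: mult.assoc)
  qed
  also have "\<dots> = 2 * (\<Sum>x\<in>X. \<Sum>j\<in>I. ?W' j x * ?B j x)"
    by (simp only: sum_distrib_left)
  also have "(\<Sum>x\<in>X. \<Sum>j\<in>I. ?W' j x * ?B j x) \<le> 768 * (\<Sum>x\<in>X. \<Sum>i\<in>I. hellinger M (Q u) i x)"
    unfolding a_def c_def by (rule cutoff_gradient_total[OF K0 KM Qu0 k anti])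
  finally have "(\<Sum>x\<in>X. Lap f x * (\<Sum>j\<in>I. k j x)) \<le>
      8 * N\<^sup>2 / K * (\<Sum>x\<in>X. u x - 1) + (193 * (\<Sum>x\<in>X. \<Sum>j\<in>I. edge_energy M V u j x)
      + 2 * (\<Sum>x\<in>X. min (u x) M * grad_energy k x) / 192 + 2 * (768 * (\<Sum>x\<in>X. \<Sum>i\<in>I. hellinger M (Q u) i x)))"
    by simp
  then have "(\<Sum>x\<in>X. Lap f x * (\<Sum>j\<in>I. k j x)) / N \<le>
      (8 * N\<^sup>2 / K * (\<Sum>x\<in>X. u x - 1) + (193 * (\<Sum>x\<in>X. \<Sum>j\<in>I. edge_energy M V u j x)
      + 2 * (\<Sum>x\<in>X. min (u x) M * grad_energy k x) / 192 + 2 * (768 * (\<Sum>x\<in>X. \<Sum>i\<in>I. hellinger M (Q u) i x)))) / N"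
    using N_pos by (intro divide_right_mono) auto
  also have "\<dots> = 8 * N / K * (\<Sum>x\<in>X. u x - 1)
      + 193 * ((\<Sum>x\<in>X. \<Sum>j\<in>I. edge_energy M V u j x) / N)
      + weighted_grad M u k / 96
      + 1536 * ((\<Sum>x\<in>X. \<Sum>i\<in>I. hellinger M (Q u) i x) / N)"
    using N_pos by (simp add: weighted_grad_def add_divide_distrib power2_eq_square)
  finally show ?thesis .
qed

end

section \<open>Pairing a field with an antisymmetric dual field\<close>

context involution_walk begin

lemma total_edge_energy:
  assumes u: "\<And>y. 1 \<le> u y" and M: "1 \<le> M" and V: "\<And>y. L2_set (\<lambda>i. V i y) I \<le> u y"
  shows "(\<Sum>t<T. (\<Sum>x\<in>X. \<Sum>j\<in>I. edge_energy M (\<lambda>i. (Q ^^ t) (V i)) ((Q ^^ t) u) j x) / N)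
    \<le> 2 * (\<Sum>x\<in>X. L2_set (\<lambda>i. V i x) I) + 8 * (ln M * (\<Sum>x\<in>X. u x - 1))"
proof -
  have up: "0 < u y" for y using u[of y] by linarith
  have "(\<Sum>t<T. (\<Sum>x\<in>X. \<Sum>j\<in>I. edge_energy M (\<lambda>i. (Q ^^ t) (V i)) ((Q ^^ t) u) j x) / N)
    = (\<Sum>t<T. (\<Sum>x\<in>X. \<Sum>j\<in>I. slope (\<lambda>i. (Q ^^ t) (V i)) ((Q ^^ t) u) j x) / N) / 2
      + 2 * (\<Sum>t<T. (\<Sum>x\<in>X. \<Sum>j\<in>I. hellinger M ((Q ^^ t) u) j x) / N)"
    by (simp add: edge_energy_def sum.distrib add_divide_distrib sum_distrib_left sum_divide_distrib mult.commute)
  then show ?thesis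
    using total_slope[where u=u and V=V and T=T, OF up V] total_hellinger[where u=u and M=M and T=T, OF u M]
    by linarith
qed

text \<open>The heart of the matter. The hypotheses on \<open>h\<close> say that it is an admissible dual field for the edge-wise
  problem, aligned with the gradient of \<open>f\<close>. The total \<open>\<Theta>\<close> of its entries equals \<open>\<langle>f, H\<rangle>\<close> for
  \<open>H = (\<Sum>j. h j)\<close>, and \<open>duhamel\<close> together with \<open>flux_step\<close> bounds this pairing by energies.
  The energy of the dual field contributes a multiple of \<open>\<Theta>\<close> itself, because
  \<open>|h i x| \<le> 1\<close> makes the \<open>L\<^sup>2\<close> mass of \<open>h\<close> at most \<open>\<Theta>\<close>; the constants are chosen so that this multiple and
  the tail together are at most \<open>\<Theta> / 2\<close>.\<close>

theorem duality_bound: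
  assumes anti: "\<And>j. j \<in> I \<Longrightarrow> antisym_along j (h j)"
    and h1: "\<And>x. normsq h x \<le> 1"
    and f1: "\<And>x. \<bar>f x\<bar> \<le> 1"
    and div: "\<And>x. Lap f x = (\<Sum>i\<in>I. 2 * D i (V i) x)"
    and gain: "\<And>i x. i \<in> I \<Longrightarrow> D i f x * h i x = \<bar>h i x\<bar>"
  shows "(\<Sum>x\<in>X. \<Sum>i\<in>I. \<bar>h i x\<bar>) \<le> 200000 * (1 + ln N) * (\<Sum>x\<in>X. L2_set (\<lambda>i. V i x) I)"
proof -
  define \<Theta> where "\<Theta> = (\<Sum>x\<in>X. \<Sum>i\<in>I. \<bar>h i x\<bar>)"
  define v where "v = (\<Sum>x\<in>X. L2_set (\<lambda>i. V i x) I)"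
  \<comment> \<open>Long enough for the tail to retain at most a quarter of \<open>\<Theta>\<close>.\<close>
  define T where "T = 2 * card I"
  \<comment> \<open>This level makes the bad set contribute \<open>v / (2 N)\<close> per step, hence \<open>v\<close> in total.\<close>
  define K where "K = 16 * N\<^sup>2"
  define M where "M = 4 * N * K"
  define l where "l = ln M"
  \<comment> \<open>The added \<open>1\<close> keeps \<open>ln u\<close> nonnegative, and the entropy charges only for the part of \<open>u\<close> above it.\<close>
  define u where "u x = L2_set (\<lambda>i. V i x) I + 1" for x
  \<comment> \<open>The dual field that occurs in \<open>duhamel\<close>.\<close>
  define k where "k j x = h j x + Q (h j) x" for j x
  define H where "H x = (\<Sum>j\<in>I. h j x)" for x
  have NN: "1 \<le> N\<^sup>2" "1 \<le> N ^ 3" using N_ge_1 by (simp_all add: one_le_power)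
  have K2: "2 \<le> K" using NN by (simp add: K_def)
  have M_eq: "M = 64 * N ^ 3" by (simp add: M_def K_def power2_eq_square power3_eq_cube)
  have M1: "1 \<le> M" using NN by (simp add: M_eq)
  have l0: "0 \<le> l" using M1 by (simp add: l_def)
  have l_le: "l \<le> 6 * (1 + ln N)"
  proof -
    have "l = 6 * ln 2 + 3 * ln N"
      using N_pos ln_realpow[of "2::real" 6] by (simp add: l_def M_eq ln_mult ln_realpow)
    moreover have "ln 2 \<le> (1::real)" using ln_le_minus_one[of "2::real"] by simp
    moreover have "0 \<le> ln N" using N_ge_1 by simp
    ultimately show ?thesis by argo
  qed
  have u1: "1 \<le> u y" for y by (simp add: u_def)
  have Vu: "L2_set (\<lambda>i. V i y) I \<le> u y" for y by (simp add: u_def)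
  have uv: "(\<Sum>x\<in>X. u x - 1) = v" by (simp add: u_def v_def)
  have v0: "0 \<le> v" by (simp add: v_def sum_nonneg)
  have \<Theta>0: "0 \<le> \<Theta>" by (simp add: \<Theta>_def sum_nonneg)
  have anti_k: "antisym_along j (k j)" if "j \<in> I" for j
    using anti[OF that] antisym_Q[OF anti[OF that]] by (simp add: antisym_along_def k_def)
  have normsq_k: "normsq k x \<le> 2 * normsq h x + 2 * normsq (\<lambda>j. Q (h j)) x" for x
  proof -
    have "normsq k x \<le> (\<Sum>j\<in>I. 2 * (h j x)\<^sup>2 + 2 * (Q (h j) x)\<^sup>2)"
      unfolding normsq_def
    proof (rule sum_mono)
      fix j show "(k j x)\<^sup>2 \<le> 2 * (h j x)\<^sup>2 + 2 * (Q (h j) x)\<^sup>2"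
        using zero_le_power2[of "h j x - Q (h j) x"]
        unfolding k_def power2_sum power2_diff by linarith
    qed
    then show ?thesis by (simp add: normsq_def sum.distrib sum_distrib_left)
  qed
  have k4: "normsq k x \<le> 4" for x
  proof -
    have "normsq (\<lambda>j. Q (h j)) x \<le> 1" using normsq_Q_le[of h 1 x] h1 by simp
    then show ?thesis using normsq_k[of x] h1[of x] by linarith
  qed
  have h_le: "\<bar>h i x\<bar> \<le> 1" if "i \<in> I" for i x
  proof -
    have "(h i x)\<^sup>2 \<le> normsq h x"
      unfolding normsq_def using that finI by (intro member_le_sum) auto
    then have "(h i x)\<^sup>2 \<le> 1" using h1[of x] by simp
    then show ?thesis by (simp add: abs_square_le_1)
  qed
  have sum_normsq_h: "(\<Sum>x\<in>X. normsq h x) \<le> \<Theta>"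
    unfolding normsq_def \<Theta>_def
  proof (intro sum_mono)
    fix x i assume "i \<in> I"
    then have "\<bar>h i x\<bar> * \<bar>h i x\<bar> \<le> \<bar>h i x\<bar> * 1"
      using h_le by (intro mult_left_mono) auto
    then show "(h i x)\<^sup>2 \<le> \<bar>h i x\<bar>" by (simp add: power2_eq_square)
  qed
  have sum_normsq_k: "(\<Sum>x\<in>X. normsq k x) \<le> 4 * \<Theta>"
  proof -
    have "(\<Sum>x\<in>X. normsq k x) \<le> (\<Sum>x\<in>X. 2 * normsq h x + 2 * normsq (\<lambda>j. Q (h j)) x)"
      by (rule sum_mono) (rule normsq_k)
    also have "\<dots> = 2 * (\<Sum>x\<in>X. normsq h x) + 2 * (\<Sum>x\<in>X. normsq (\<lambda>j. Q (h j)) x)"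
      by (simp add: sum.distrib sum_distrib_left)
    finally show ?thesis using sum_normsq_Q[of h] sum_normsq_h by linarith
  qed
  have \<Theta>_pair: "\<Theta> = (\<Sum>x\<in>X. f x * H x)"
  proof -
    have "\<Theta> = (\<Sum>x\<in>X. \<Sum>i\<in>I. D i f x * h i x)"
      unfolding \<Theta>_def using gain by (intro sum.cong refl) simp
    also have "\<dots> = (\<Sum>i\<in>I. \<Sum>x\<in>X. f x * D i (h i) x)"
      by (subst sum.swap) (intro sum.cong refl D_parts)
    also have "\<dots> = (\<Sum>i\<in>I. \<Sum>x\<in>X. f x * h i x)"
      by (intro sum.cong refl) (simp add: antisym_D_eq[OF anti])
    also have "\<dots> = (\<Sum>x\<in>X. f x * H x)"
      by (simp add: H_def sum_distrib_left sum.swap[of _ X])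
    finally show ?thesis .
  qed
  have ft1: "\<bar>(Q ^^ t) f x\<bar> \<le> 1" for t x
  proof -
    have "f y \<le> 1" "- 1 \<le> f y" for y using f1[of y] by auto
    then show ?thesis
      using Qpow_mono[of f "\<lambda>y. 1" t x] Qpow_mono[of "\<lambda>y. -1" f t x] by (simp add: abs_le_iff)
  qed
  have lap_ft: "\<bar>Lap ((Q ^^ t) f) x\<bar> \<le> N" for t x
  proof -
    have "\<bar>D i ((Q ^^ t) f) x\<bar> \<le> 1" for i
      using ft1[of t x] ft1[of t "\<sigma> i x"] by (simp add: D_def abs_le_iff)
    then have "\<bar>Lap ((Q ^^ t) f) x\<bar> \<le> (\<Sum>i\<in>I. 1)"
      unfolding Lap_def by (intro order_trans[OF sum_abs] sum_mono) auto
    then show ?thesis by simp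
  qed
  have tail: "(\<Sum>x\<in>X. (Q ^^ T) f x * (Q ^^ T) H x) \<le> \<Theta> / 4"
  proof -
    have "(\<Sum>x\<in>X. (Q ^^ T) f x * (Q ^^ T) H x) \<le> (\<Sum>x\<in>X. \<Sum>j\<in>I. \<bar>(Q ^^ T) (h j) x\<bar>)"
    proof (rule sum_mono)
      fix x
      have "(Q ^^ T) f x * (Q ^^ T) H x \<le> \<bar>(Q ^^ T) f x\<bar> * \<bar>(Q ^^ T) H x\<bar>"
        by (metis abs_ge_self abs_mult)
      also have "\<dots> \<le> 1 * \<bar>(Q ^^ T) H x\<bar>" using ft1 by (intro mult_right_mono) auto
      also have "\<dots> = \<bar>\<Sum>j\<in>I. (Q ^^ T) (h j) x\<bar>"
        by (simp add: H_def[abs_def] Qpow_sum)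
      also have "\<dots> \<le> (\<Sum>j\<in>I. \<bar>(Q ^^ T) (h j) x\<bar>)" by (rule sum_abs)
      finally show "(Q ^^ T) f x * (Q ^^ T) H x \<le> (\<Sum>j\<in>I. \<bar>(Q ^^ T) (h j) x\<bar>)" .
    qed
    also have "\<dots> = (\<Sum>j\<in>I. \<Sum>x\<in>X. \<bar>(Q ^^ T) (h j) x\<bar>)" by (rule sum.swap)
    also have "\<dots> \<le> (\<Sum>j\<in>I. (1 - 1 / N) ^ T * (\<Sum>x\<in>X. \<bar>h j x\<bar>))"
      by (intro sum_mono antisym_Qpow_L1) (auto intro: anti)
    also have "\<dots> = (1 - 1 / N) ^ T * \<Theta>"
      by (simp add: \<Theta>_def sum_distrib_left sum.swap[of _ X])
    also have "\<dots> \<le> 1 / 4 * \<Theta>"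
      using decay_constant \<Theta>0 unfolding T_def by (rule mult_right_mono)
    finally show ?thesis by simp
  qed
  define E where "E t = (\<Sum>x\<in>X. \<Sum>j\<in>I. edge_energy M (\<lambda>i. (Q ^^ t) (V i)) ((Q ^^ t) u) j x) / N" for t
  define F where "F t = weighted_grad M ((Q ^^ t) u) (\<lambda>j. (Q ^^ t) (k j))" for t
  define G where "G t = (\<Sum>x\<in>X. \<Sum>i\<in>I. hellinger M ((Q ^^ t) u) i x) / N" for t
  have step: "(\<Sum>x\<in>X. Lap ((Q ^^ t) f) x * ((Q ^^ t) H x + (Q ^^ Suc t) H x)) / N
      \<le> v / (2 * N) + 193 * E t + F t / 96 + 1536 * G (Suc t)" for t
  proof -
    have "(Q ^^ t) H x + (Q ^^ Suc t) H x = (\<Sum>j\<in>I. (Q ^^ t) (k j) x)" for x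
    proof -
      have "(Q ^^ t) (k j) x = (Q ^^ t) (h j) x + (Q ^^ Suc t) (h j) x" for j
      proof -
        have "(Q ^^ t) (\<lambda>x. h j x + Q (h j) x) = (\<lambda>x. (Q ^^ t) (h j) x + (Q ^^ t) (Q (h j)) x)"
          by (induction t) (simp_all add: Q_add)
        then show ?thesis by (simp add: k_def[abs_def] funpow_swap1)
      qed
      then show ?thesis by (simp add: H_def[abs_def] Qpow_sum sum.distrib Q_sum)
    qed
    moreover have "(\<Sum>x\<in>X. Lap ((Q ^^ t) f) x * (\<Sum>j\<in>I. (Q ^^ t) (k j) x)) / N
      \<le> 8 * N / K * (\<Sum>x\<in>X. (Q ^^ t) u x - 1) + 193 * E t + F t / 96 + 1536 * G (Suc t)"
      unfolding E_def F_def G_def funpow.simps o_apply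
    proof (rule flux_step)
      show "2 \<le> K" by (rule K2)
      show "4 * N * K \<le> M" by (simp add: M_def)
      show "1 \<le> (Q ^^ t) u y" for y by (rule Qpow_ge_1[OF u1])
      show "L2_set (\<lambda>i. (Q ^^ t) (V i) y) I \<le> (Q ^^ t) u y" for y by (rule Qpow_norm_le[OF Vu])
      show "normsq (\<lambda>j. (Q ^^ t) (k j)) x \<le> 4" for x
        using normsq_Qpow_le[of k 2 t x] k4 by simp
      show "antisym_along j ((Q ^^ t) (k j))" if "j \<in> I" for j
        by (rule antisym_Qpow[OF anti_k[OF that]])
      show "\<bar>Lap ((Q ^^ t) f) x\<bar> \<le> N" for x by (rule lap_ft)
      show "Lap ((Q ^^ t) f) x = (\<Sum>i\<in>I. 2 * D i ((Q ^^ t) (V i)) x)" for x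
      proof -
        have "Lap f = (\<lambda>x. \<Sum>i\<in>I. 2 * D i (V i) x)" using div by (simp add: fun_eq_iff)
        then show ?thesis by (simp add: Qpow_Lap Qpow_sum Qpow_cmult Qpow_D)
      qed
    qed
    moreover have "(\<Sum>x\<in>X. (Q ^^ t) u x - 1) = v"
      using uv by (simp add: sum_subtractf sum_Qpow)
    moreover have "8 * N / K * v = v / (2 * N)"
      using N_pos by (simp add: K_def power2_eq_square)
    ultimately show ?thesis by simp
  qed
  have ET: "(\<Sum>t<T. E t) \<le> 2 * v + 8 * (l * v)"
    using total_edge_energy[where u=u and M=M and V=V and T=T, OF u1 M1 Vu] uv by (simp add: E_def l_def v_def)
  have FT: "(\<Sum>t<T. F t) \<le> 40 * v + 1024 * (l * v) + 24 * \<Theta>"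
    using total_weighted_grad[where u=u and M=M and k=k and T=T, OF u1 M1 k4] uv sum_normsq_k
    by (simp add: F_def l_def algebra_simps)
  have GT: "(\<Sum>t<T. G (Suc t)) \<le> 4 * (l * v)"
  proof -
    have "0 \<le> G 0" using N_pos by (simp add: G_def sum_nonneg)
    then have "(\<Sum>t<T. G (Suc t)) \<le> (\<Sum>t<Suc T. G t)" by (simp only: sum.lessThan_Suc_shift)
    also have "\<dots> \<le> 4 * (l * v)"
      using total_hellinger[where u=u and M=M and T="Suc T", OF u1 M1] uv unfolding G_def l_def by simp
    finally show ?thesis .
  qed
  have "(\<Sum>t<T. \<Sum>x\<in>X. Lap ((Q ^^ t) f) x * ((Q ^^ t) H x + (Q ^^ Suc t) H x)) / N
     = (\<Sum>t<T. (\<Sum>x\<in>X. Lap ((Q ^^ t) f) x * ((Q ^^ t) H x + (Q ^^ Suc t) H x)) / N)"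
    by (rule sum_divide_distrib)
  also have "\<dots> \<le> (\<Sum>t<T. v / (2 * N) + 193 * E t + F t / 96 + 1536 * G (Suc t))"
    by (intro sum_mono step)
  also have "\<dots> = real T * (v / (2 * N)) + 193 * (\<Sum>t<T. E t) + (\<Sum>t<T. F t) / 96 + 1536 * (\<Sum>t<T. G (Suc t))"
    by (simp add: sum.distrib sum_distrib_left sum_divide_distrib)
  also have "real T * (v / (2 * N)) = v"
    using N_pos by (simp add: T_def)
  finally have "\<Theta> \<le> v + 193 * (\<Sum>t<T. E t) + (\<Sum>t<T. F t) / 96 + 1536 * (\<Sum>t<T. G (Suc t)) + \<Theta> / 4"
    using duhamel[of f H T] tail \<Theta>_pair by argo
  then have "\<Theta> \<le> v + 193 * (2 * v + 8 * (l * v)) + (40 * v + 1024 * (l * v) + 24 * \<Theta>) / 96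
      + 1536 * (4 * (l * v)) + \<Theta> / 4"
    using ET FT GT by argo
  then have "\<Theta> \<le> 1000 * v + 20000 * (l * v)"
    using v0 mult_nonneg_nonneg[OF l0 v0] by argo
  also have "l * v \<le> 6 * (1 + ln N) * v"
    using l_le v0 by (rule mult_right_mono)
  also have "1000 * v + 20000 * (6 * (1 + ln N) * v) \<le> 200000 * (1 + ln N) * v"
  proof -
    have "0 \<le> ln N * v" using N_ge_1 v0 by simp
    with v0 show ?thesis by (simp add: algebra_simps)
  qed
  finally show ?thesis by (simp add: \<Theta>_def v_def)
qed

end

section \<open>Balanced colorings of the sensitive edges\<close>

text \<open>At either end of the interval the function decreases inwards, so it is minimal at a critical point.\<close>

lemma balanced_minimum:
  fixes P R \<tau> :: real
  assumes P: "0 < P" and R: "0 < R" and \<tau>: "0 \<le> \<tau>" "\<tau> \<le> 1"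
    and min: "\<And>s. 0 \<le> s \<Longrightarrow> s \<le> 1 \<Longrightarrow>
      sqrt (P + \<tau>\<^sup>2) + sqrt (R + (1 - \<tau>)\<^sup>2) \<le> sqrt (P + s\<^sup>2) + sqrt (R + (1 - s)\<^sup>2)"
  shows "\<tau> / sqrt (P + \<tau>\<^sup>2) = (1 - \<tau>) / sqrt (R + (1 - \<tau>)\<^sup>2)"
proof -
  define \<phi> where "\<phi> s = sqrt (P + s\<^sup>2) + sqrt (R + (1 - s)\<^sup>2)" for s
  define d where "d = \<tau> / sqrt (P + \<tau>\<^sup>2) - (1 - \<tau>) / sqrt (R + (1 - \<tau>)\<^sup>2)"
  have pos: "0 < P + \<tau>\<^sup>2" "0 < R + (1 - \<tau>)\<^sup>2"
    using P R by (simp_all add: add_pos_nonneg)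
  have der: "(\<phi> has_real_derivative d) (at \<tau>)"
    unfolding \<phi>_def[abs_def] d_def using pos
    by (auto intro!: derivative_eq_intros simp: field_simps)
  have min': "\<phi> \<tau> \<le> \<phi> s" if "0 \<le> s" "s \<le> 1" for s
    using min[OF that] by (simp add: \<phi>_def)
  have "\<not> d > 0"
  proof
    assume d: "d > 0"
    have "\<tau> > 0"
    proof (rule ccontr)
      assume "\<not> \<tau> > 0"
      with \<tau> have "\<tau> = 0" by simp
      then have "d \<le> 0" using R by (simp add: d_def)
      with d show False by simp
    qed
    obtain e where e: "e > 0" "\<And>h. 0 < h \<Longrightarrow> h < e \<Longrightarrow> \<phi> (\<tau> - h) < \<phi> \<tau>"
      using DERIV_pos_inc_left[OF der d] by blast
    define h where "h = min (e / 2) \<tau>"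
    have "0 < h" "h < e" "h \<le> \<tau>" using e \<open>\<tau> > 0\<close> by (auto simp: h_def)
    then show False using e(2)[of h] min'[of "\<tau> - h"] \<tau> by auto
  qed
  moreover have "\<not> d < 0"
  proof
    assume d: "d < 0"
    have "\<tau> < 1"
    proof (rule ccontr)
      assume "\<not> \<tau> < 1"
      with \<tau> have "\<tau> = 1" by simp
      then have "d \<ge> 0" using P by (simp add: d_def)
      with d show False by simp
    qed
    obtain e where e: "e > 0" "\<And>h. 0 < h \<Longrightarrow> h < e \<Longrightarrow> \<phi> (\<tau> + h) < \<phi> \<tau>"
      using DERIV_neg_dec_right[OF der d] by blast
    define h where "h = min (e / 2) (1 - \<tau>)"
    have "0 < h" "h < e" "h \<le> 1 - \<tau>" using e \<open>\<tau> < 1\<close> by (auto simp: h_def)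
    then show False using e(2)[of h] min'[of "\<tau> + h"] \<tau> by auto
  qed
  ultimately show ?thesis by (simp add: d_def)
qed

lemma flip_commute: "flip i (flip j x) = flip j (flip i x)"
  by (cases "i = j") (auto simp: flip_def fun_eq_iff)

lemma flip_cube: "i \<in> {1..n} \<Longrightarrow> x \<in> cube n \<Longrightarrow> flip i x \<in> cube n"
  unfolding cube_def flip_def by (auto simp: PiE_iff extensional_def)

lemma flip_cube_iff: "i \<in> {1..n} \<Longrightarrow> flip i x \<in> cube n \<longleftrightarrow> x \<in> cube n"
  using flip_cube[of i n x] flip_cube[of i n "flip i x"] by auto

lemma finite_cube: "finite (cube n)"
  unfolding cube_def by (intro finite_PiE) auto

lemma cube_nonempty: "cube n \<noteq> {}"
  unfolding cube_def by (auto simp: PiE_eq_empty_iff)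

lemma cube_coord: "x \<in> cube n \<Longrightarrow> i \<in> {1..n} \<Longrightarrow> x i = -1 \<or> x i = 1"
  unfolding cube_def by (auto simp: PiE_iff)

lemma flip_inj_index:
  assumes x: "x \<in> cube n" and i: "i \<in> {1..n}" and eq: "flip i x = flip j x"
  shows "i = j"
proof (rule ccontr)
  assume "i \<noteq> j"
  then have "- x i = x i" using fun_cong[OF eq, of i] by (simp add: flip_def)
  then show False using cube_coord[OF x i] by auto
qed

lemma edge_eqD:
  assumes x: "x \<in> cube n" and z: "z \<in> cube n" and i: "i \<in> {1..n}" and j: "j \<in> {1..n}"
    and eq: "{z, flip j z} = {x, flip i x}"
  shows "j = i \<and> (z = x \<or> z = flip i x)"
proof -
  from eq consider "z = x" "flip j z = flip i x" | "z = flip i x" "flip j z = x"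
    by (auto simp: doubleton_eq_iff)
  then show ?thesis
  proof cases
    case 1
    then show ?thesis using flip_inj_index[OF x i, of j] by simp
  next
    case 2
    then have "flip i z = flip j z" by simp
    from flip_inj_index[OF z i this] 2(1) show ?thesis by simp
  qed
qed

text \<open>The part of the unit jump of \<open>f\<close> across the edge \<open>{x, flip i x}\<close> that a coloring charges to the
  end \<open>x\<close>; the two ends of a sensitive edge share it.\<close>

definition share :: "((nat \<Rightarrow> real) \<Rightarrow> real) \<Rightarrow> ((nat \<Rightarrow> real) set \<Rightarrow> real) \<Rightarrow> (nat \<Rightarrow> real) \<Rightarrow> nat \<Rightarrow> real" where
  "share f \<theta> x i = (if f x = f (flip i x) then 0
     else if f x = 1 then \<theta> {x, flip i x} else 1 - \<theta> {x, flip i x})"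

lemma expect_sum: "expect n g = (\<Sum>x\<in>cube n. g x) / real (card (cube n))"
  unfolding expect_def using finite_cube cube_nonempty by (simp add: integral_pmf_of_set)

lemma talagrand_coloring_share:
  assumes f: "f \<in> cube n \<rightarrow> {-1, 1}"
  shows "talagrand_coloring n f \<theta>
    = (\<Sum>x\<in>cube n. sqrt (\<Sum>i\<in>{1..n}. (share f \<theta> x i)\<^sup>2)) / real (card (cube n))"
  unfolding talagrand_coloring_def expect_sum
proof (intro arg_cong2[where f="(/)"] sum.cong refl arg_cong[where f=sqrt])
  fix x assume x: "x \<in> cube n"
  let ?A = "{i \<in> {1..n}. f x = 1 \<and> f (flip i x) = -1}"
  let ?B = "{i \<in> {1..n}. f x = -1 \<and> f (flip i x) = 1}"
  have fx: "f x = 1 \<or> f x = -1" and fy: "i \<in> {1..n} \<Longrightarrow> f (flip i x) = 1 \<or> f (flip i x) = -1" for i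
    using f x flip_cube[OF _ x] by (auto simp: Pi_iff)
  have "(\<Sum>i\<in>{1..n}. (share f \<theta> x i)\<^sup>2) = (\<Sum>i\<in>?A \<union> ?B. (share f \<theta> x i)\<^sup>2)"
  proof (intro sum.mono_neutral_right ballI)
    fix i assume "i \<in> {1..n} - (?A \<union> ?B)"
    then show "(share f \<theta> x i)\<^sup>2 = 0" using fx fy[of i] by (auto simp: share_def)
  qed auto
  also have "\<dots> = (\<Sum>i\<in>?A. (share f \<theta> x i)\<^sup>2) + (\<Sum>i\<in>?B. (share f \<theta> x i)\<^sup>2)"
    by (rule sum.union_disjoint) auto
  also have "\<dots> = (\<Sum>i\<in>?A. (\<theta> {x, flip i x})\<^sup>2) + (\<Sum>i\<in>?B. (1 - \<theta> {x, flip i x})\<^sup>2)"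
    by (intro arg_cong2[where f="(+)"] sum.cong refl) (auto simp: share_def)
  finally show "(\<Sum>i | i \<in> {1..n} \<and> f x = 1 \<and> f (flip i x) = -1. (\<theta> {x, flip i x})\<^sup>2)
     + (\<Sum>i | i \<in> {1..n} \<and> f x = -1 \<and> f (flip i x) = 1. (1 - \<theta> {x, flip i x})\<^sup>2)
     = (\<Sum>i\<in>{1..n}. (share f \<theta> x i)\<^sup>2)" by simp
qed

text \<open>The coloring cost with its square roots smoothed at \<open>0\<close>, so that minimisers satisfy an
  Euler-Lagrange equation even at points that carry no share.\<close>

definition smoothed_cost :: "nat \<Rightarrow> real \<Rightarrow> ((nat \<Rightarrow> real) \<Rightarrow> real) \<Rightarrow> ((nat \<Rightarrow> real) set \<Rightarrow> real) \<Rightarrow> real" where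
  "smoothed_cost n \<epsilon> f \<theta> = (\<Sum>x\<in>cube n. sqrt (\<epsilon>\<^sup>2 + (\<Sum>i\<in>{1..n}. (share f \<theta> x i)\<^sup>2)))"

lemma smoothed_minimiser:
  "\<exists>\<theta> \<in> UNIV \<rightarrow> {0..1}. \<forall>\<theta>' \<in> UNIV \<rightarrow> {0..1}. smoothed_cost n \<epsilon> f \<theta> \<le> smoothed_cost n \<epsilon> f \<theta>'"
proof -
  let ?K = "PiE UNIV (\<lambda>_. {0..1}) :: ((nat \<Rightarrow> real) set \<Rightarrow> real) set"
  have "compactin (product_topology (\<lambda>_. euclidean) UNIV) ?K"
    by (subst compactin_PiE) auto
  then have comp: "compact ?K" by (simp add: euclidean_product_topology)
  have ne: "?K \<noteq> {}" by (simp add: PiE_eq_empty_iff)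
  have "continuous_on ?K (\<lambda>\<theta>. share f \<theta> x i)" for x i
    unfolding share_def
    by (cases "f x = f (flip i x)"; cases "f x = 1")
      (auto intro!: continuous_intros continuous_on_subset[OF continuous_on_product_coordinates])
  then have cont: "continuous_on ?K (smoothed_cost n \<epsilon> f)"
    unfolding smoothed_cost_def[abs_def] by (intro continuous_intros)
  from continuous_attains_inf[OF comp ne cont] show ?thesis by (auto simp: PiE_UNIV_domain)
qed

text \<open>The Euler-Lagrange equation of a minimiser. The value \<open>\<theta> {x, flip i x}\<close> enters the cost only through the two
  ends of that edge, so \<open>balanced_minimum\<close> applies to it.\<close>

lemma minimiser_balanced:
  assumes \<epsilon>: "0 < \<epsilon>" and \<theta>: "\<theta> \<in> UNIV \<rightarrow> {0..1}"
    and min: "\<And>\<theta>'. \<theta>' \<in> UNIV \<rightarrow> {0..1} \<Longrightarrow> smoothed_cost n \<epsilon> f \<theta> \<le> smoothed_cost n \<epsilon> f \<theta>'"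
    and x: "x \<in> cube n" and i: "i \<in> {1..n}" and fx: "f x = 1" and fy: "f (flip i x) = -1"
  shows "share f \<theta> x i / sqrt (\<epsilon>\<^sup>2 + (\<Sum>j\<in>{1..n}. (share f \<theta> x j)\<^sup>2))
    = share f \<theta> (flip i x) i / sqrt (\<epsilon>\<^sup>2 + (\<Sum>j\<in>{1..n}. (share f \<theta> (flip i x) j)\<^sup>2))"
proof -
  define y where "y = flip i x"
  define \<tau> where "\<tau> = \<theta> {x, y}"
  define P where "P = \<epsilon>\<^sup>2 + (\<Sum>j\<in>{1..n}-{i}. (share f \<theta> x j)\<^sup>2)"
  define R where "R = \<epsilon>\<^sup>2 + (\<Sum>j\<in>{1..n}-{i}. (share f \<theta> y j)\<^sup>2)"
  define rest where "rest = (\<Sum>z\<in>cube n - {x, y}. sqrt (\<epsilon>\<^sup>2 + (\<Sum>j\<in>{1..n}. (share f \<theta> z j)\<^sup>2)))"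
  have y: "y \<in> cube n" using flip_cube[OF i x] by (simp add: y_def)
  have xy: "x \<noteq> y" using fx fy by (auto simp: y_def)
  have yx: "flip i y = x" by (simp add: y_def)
  have PR: "0 < P" "0 < R" using \<epsilon> by (simp_all add: P_def R_def add_pos_nonneg sum_nonneg)
  have upd: "share f (\<theta>({x, y} := s)) z j = share f \<theta> z j"
    if "z \<in> cube n" "j \<in> {1..n}" "\<not> (j = i \<and> (z = x \<or> z = y))" for s z j
  proof -
    have "{z, flip j z} \<noteq> {x, y}"
      using edge_eqD[OF x that(1) i that(2)] that(3) unfolding y_def by blast
    then show ?thesis by (simp add: share_def)
  qed
  have at_x: "\<epsilon>\<^sup>2 + (\<Sum>j\<in>{1..n}. (share f (\<theta>({x, y} := s)) x j)\<^sup>2) = P + s\<^sup>2" for s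
  proof -
    have "(\<Sum>j\<in>{1..n}-{i}. (share f (\<theta>({x, y} := s)) x j)\<^sup>2) = (\<Sum>j\<in>{1..n}-{i}. (share f \<theta> x j)\<^sup>2)"
      using upd[OF x] by (intro sum.cong refl) auto
    moreover have "share f (\<theta>({x, y} := s)) x i = s" using fx fy by (simp add: share_def y_def)
    ultimately show ?thesis
      unfolding P_def using sum.remove[of "{1..n}" i "\<lambda>j. (share f (\<theta>({x, y} := s)) x j)\<^sup>2"] i by simp
  qed
  have at_y: "\<epsilon>\<^sup>2 + (\<Sum>j\<in>{1..n}. (share f (\<theta>({x, y} := s)) y j)\<^sup>2) = R + (1 - s)\<^sup>2" for s
  proof -
    have "(\<Sum>j\<in>{1..n}-{i}. (share f (\<theta>({x, y} := s)) y j)\<^sup>2) = (\<Sum>j\<in>{1..n}-{i}. (share f \<theta> y j)\<^sup>2)"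
      using upd[OF y] by (intro sum.cong refl) auto
    moreover have "share f (\<theta>({x, y} := s)) y i = 1 - s"
      using fx fy by (simp add: share_def y_def insert_commute)
    ultimately show ?thesis
      unfolding R_def using sum.remove[of "{1..n}" i "\<lambda>j. (share f (\<theta>({x, y} := s)) y j)\<^sup>2"] i by simp
  qed
  have cost: "smoothed_cost n \<epsilon> f (\<theta>({x, y} := s)) = sqrt (P + s\<^sup>2) + sqrt (R + (1 - s)\<^sup>2) + rest" for s
  proof -
    let ?g = "\<lambda>z. sqrt (\<epsilon>\<^sup>2 + (\<Sum>j\<in>{1..n}. (share f (\<theta>({x, y} := s)) z j)\<^sup>2))"
    have "(\<Sum>z\<in>cube n. ?g z) = (\<Sum>z\<in>cube n - {x, y}. ?g z) + (\<Sum>z\<in>{x, y}. ?g z)"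
      using x y finite_cube by (intro sum.subset_diff) auto
    also have "(\<Sum>z\<in>cube n - {x, y}. ?g z) = rest"
      unfolding rest_def using upd
      by (intro sum.cong refl arg_cong[where f=sqrt] arg_cong2[where f="(+)"]) (auto intro!: sum.cong)
    also have "(\<Sum>z\<in>{x, y}. ?g z) = sqrt (P + s\<^sup>2) + sqrt (R + (1 - s)\<^sup>2)"
    proof -
      have "(\<Sum>z\<in>{x, y}. ?g z) = ?g x + ?g y" using xy by simp
      then show ?thesis by (simp only: at_x at_y)
    qed
    finally show ?thesis unfolding smoothed_cost_def by linarith
  qed
  have self: "\<theta>({x, y} := \<tau>) = \<theta>" by (simp add: \<tau>_def)
  have "\<tau> / sqrt (P + \<tau>\<^sup>2) = (1 - \<tau>) / sqrt (R + (1 - \<tau>)\<^sup>2)"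
  proof (rule balanced_minimum[OF PR])
    show "0 \<le> \<tau>" "\<tau> \<le> 1" using \<theta> by (auto simp: \<tau>_def Pi_iff)
    fix s :: real assume "0 \<le> s" "s \<le> 1"
    then have "\<theta>({x, y} := s) \<in> UNIV \<rightarrow> {0..1}" using \<theta> by (auto simp: Pi_iff)
    from min[OF this] show "sqrt (P + \<tau>\<^sup>2) + sqrt (R + (1 - \<tau>)\<^sup>2) \<le> sqrt (P + s\<^sup>2) + sqrt (R + (1 - s)\<^sup>2)"
      using cost[of s] cost[of \<tau>] by (simp add: self)
  qed
  moreover have "share f \<theta> x i = \<tau>" "share f \<theta> y i = 1 - \<tau>"
    using fx fy by (simp_all add: share_def y_def \<tau>_def insert_commute)
  ultimately show ?thesis
    using at_x[of \<tau>] at_y[of \<tau>] unfolding self y_def[symmetric] by simp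
qed

section \<open>Comparison of the two boundaries\<close>

lemma sqrt_le_smoothed:
  fixes S \<epsilon> :: real assumes "0 < \<epsilon>" "0 \<le> S"
  shows "sqrt S \<le> S / sqrt (\<epsilon>\<^sup>2 + S) + \<epsilon>"
proof -
  define r where "r = sqrt (\<epsilon>\<^sup>2 + S)"
  have r: "\<epsilon> \<le> r" "sqrt S \<le> r" "0 < r"
    using assms unfolding r_def by (auto intro!: real_le_rsqrt add_pos_nonneg)
  have "r * r = \<epsilon> * \<epsilon> + S" using assms by (simp add: r_def power2_eq_square)
  then have "S / r = r - \<epsilon> * \<epsilon> / r" using r by (simp add: field_simps)
  moreover have "\<epsilon> * \<epsilon> / r \<le> \<epsilon>"
    using r assms by (simp add: pos_divide_le_eq mult_left_mono)
  ultimately show ?thesis using r unfolding r_def[symmetric] by linarith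
qed

lemma cube_walk: "1 \<le> n \<Longrightarrow> involution_walk (cube n) {1..n} flip"
  by unfold_locales (auto simp: finite_cube flip_commute flip_cube)

text \<open>The balanced ratios \<open>share / norm\<close> of a minimiser, signed by \<open>f\<close>, form the dual field. Balance is
  exactly antisymmetry across edges, the common denominator at each point gives length at most \<open>1\<close>, and
  pairing the field with the shares returns the cost up to \<open>\<epsilon>\<close>. Functions are extended by \<open>0\<close> off the
  cube, which flips by an index in \<open>{1..n}\<close> preserve, so the hypotheses of \<open>duality_bound\<close> hold everywhere.\<close>

lemma talagrand_le_field:
  assumes n: "1 \<le> n" and f: "f \<in> cube n \<rightarrow> {-1, 1}" and V: "V \<in> beckmann_fields n f" and \<epsilon>: "0 < \<epsilon>"
  shows "talagrand_frac n f \<le> 200000 * ln (exp 1 * real n) * expect n (\<lambda>x. L2_set (V x) {1..n}) + \<epsilon>"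
proof -
  interpret involution_walk "cube n" "{1..n}" flip by (rule cube_walk[OF n])
  have N: "N = real n" unfolding N_def by simp
  obtain \<theta> where \<theta>: "\<theta> \<in> UNIV \<rightarrow> {0..1}"
    and min: "\<And>\<theta>'. \<theta>' \<in> UNIV \<rightarrow> {0..1} \<Longrightarrow> smoothed_cost n \<epsilon> f \<theta> \<le> smoothed_cost n \<epsilon> f \<theta>'"
    using smoothed_minimiser by blast
  define w where "w x i = share f \<theta> x i" for x i
  define r where "r x = sqrt (\<epsilon>\<^sup>2 + (\<Sum>i\<in>{1..n}. (w x i)\<^sup>2))" for x
  define h where "h i x = (if x \<in> cube n then f x * w x i / r x else 0)" for i x
  define f' where "f' x = (if x \<in> cube n then f x else 0)" for x
  define V' where "V' i x = (if x \<in> cube n then V x i else 0)" for i x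
  have r0: "0 < r x" for x using \<epsilon> by (simp add: r_def add_pos_nonneg sum_nonneg)
  have w01: "0 \<le> w x i" "w x i \<le> 1" for x i
    using \<theta> by (auto simp: w_def share_def Pi_iff)
  have fpm: "f x = 1 \<or> f x = -1" if "x \<in> cube n" for x using f that by (auto simp: Pi_iff)
  have balance: "w x i / r x = w (flip i x) i / r (flip i x)" if x: "x \<in> cube n" and i: "i \<in> {1..n}" for x i
  proof -
    have y: "flip i x \<in> cube n" by (rule flip_cube[OF i x])
    consider "f x = f (flip i x)" | "f x = 1" "f (flip i x) = -1" | "f x = -1" "f (flip i x) = 1"
      using fpm[OF x] fpm[OF y] by auto
    then show ?thesis
    proof cases
      case 1 then show ?thesis by (simp add: w_def share_def)
    next
      case 2 then show ?thesis
        using minimiser_balanced[OF \<epsilon> \<theta> min x i] by (simp add: w_def r_def)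
    next
      case 3 then show ?thesis
        using minimiser_balanced[OF \<epsilon> \<theta> min y i] by (simp add: w_def r_def)
    qed
  qed
  have anti: "antisym_along i (h i)" if i: "i \<in> {1..n}" for i
    unfolding antisym_along_def
  proof
    fix x
    show "h i (flip i x) = - h i x"
    proof (cases "x \<in> cube n")
      case False
      then show ?thesis using i by (simp add: h_def flip_cube_iff)
    next
      case True
      have y: "flip i x \<in> cube n" by (rule flip_cube[OF i True])
      have "f x = f (flip i x) \<or> f (flip i x) = - f x" using fpm[OF True] fpm[OF y] by auto
      then show ?thesis
      proof
        assume "f x = f (flip i x)"
        then show ?thesis by (simp add: h_def w_def share_def)
      next
        assume s: "f (flip i x) = - f x"
        have "h i (flip i x) = f (flip i x) * (w (flip i x) i / r (flip i x))" using y by (simp add: h_def)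
        also have "\<dots> = - (f x * (w x i / r x))" using balance[OF True i] s by simp
        finally show ?thesis using True by (simp add: h_def)
      qed
    qed
  qed
  have h1: "normsq h x \<le> 1" for x
  proof (cases "x \<in> cube n")
    case True
    have "(f x)\<^sup>2 = 1" using fpm[OF True] by auto
    then have "normsq h x = (\<Sum>i\<in>{1..n}. (w x i)\<^sup>2) / (r x)\<^sup>2"
      unfolding normsq_def using True by (simp add: h_def power_divide power_mult_distrib sum_divide_distrib)
    also have "\<dots> \<le> 1"
      using r0[of x] by (simp add: r_def sum_nonneg divide_le_eq_1)
    finally show ?thesis .
  qed (unfold normsq_def, simp add: h_def)
  have f1: "\<bar>f' x\<bar> \<le> 1" for x using fpm[of x] by (auto simp: f'_def)
  have absh: "\<bar>h i x\<bar> = w x i / r x" if "x \<in> cube n" for i x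
    using fpm[OF that] w01[of x i] r0[of x] that by (auto simp: h_def abs_mult)
  have div: "Lap f' x = (\<Sum>i\<in>{1..n}. 2 * D i (V' i) x)" for x
  proof (cases "x \<in> cube n")
    case True
    have "Lap f' x = laplacian n f x"
      unfolding Lap_def laplacian_def
      by (intro sum.cong refl) (simp add: D_def deriv_coord_def f'_def True flip_cube)
    also have "\<dots> = divergence n V x" using V True by (simp add: beckmann_fields_def)
    also have "\<dots> = (\<Sum>i\<in>{1..n}. 2 * D i (V' i) x)"
      unfolding divergence_def
      by (intro sum.cong refl) (simp add: D_def V'_def True flip_cube)
    finally show ?thesis .
  next
    case False
    then show ?thesis
      unfolding Lap_def by (intro sum.cong refl) (simp add: D_def f'_def V'_def flip_cube_iff)
  qed
  have gain: "D i f' x * h i x = \<bar>h i x\<bar>" if i: "i \<in> {1..n}" for i x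
  proof (cases "x \<in> cube n")
    case True
    have y: "flip i x \<in> cube n" by (rule flip_cube[OF i True])
    show ?thesis
    proof (cases "f x = f (flip i x)")
      case True
      then show ?thesis by (simp add: h_def w_def share_def)
    next
      case False
      then have "D i f' x = f x" using fpm[OF True] fpm[OF y] True y by (auto simp: D_def f'_def)
      then show ?thesis using absh[OF True] fpm[OF True] True by (auto simp: h_def)
    qed
  qed (simp add: h_def)
  have "(\<Sum>x\<in>cube n. sqrt (\<Sum>i\<in>{1..n}. (w x i)\<^sup>2)) \<le> (\<Sum>x\<in>cube n. (\<Sum>i\<in>{1..n}. \<bar>h i x\<bar>) + \<epsilon>)"
  proof (rule sum_mono)
    fix x assume x: "x \<in> cube n"
    have "sqrt (\<Sum>i\<in>{1..n}. (w x i)\<^sup>2) \<le> (\<Sum>i\<in>{1..n}. (w x i)\<^sup>2) / r x + \<epsilon>"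
      unfolding r_def by (rule sqrt_le_smoothed[OF \<epsilon>]) (simp add: sum_nonneg)
    also have "(\<Sum>i\<in>{1..n}. (w x i)\<^sup>2) / r x \<le> (\<Sum>i\<in>{1..n}. \<bar>h i x\<bar>)"
      unfolding sum_divide_distrib absh[OF x]
    proof (intro sum_mono divide_right_mono)
      fix i
      show "(w x i)\<^sup>2 \<le> w x i"
        using w01[of x i] mult_left_le[of "w x i" "w x i"] by (simp add: power2_eq_square)
    qed (use r0[of x] in auto)
    finally show "sqrt (\<Sum>i\<in>{1..n}. (w x i)\<^sup>2) \<le> (\<Sum>i\<in>{1..n}. \<bar>h i x\<bar>) + \<epsilon>" by simp
  qed
  also have "\<dots> = (\<Sum>x\<in>cube n. \<Sum>i\<in>{1..n}. \<bar>h i x\<bar>) + real (card (cube n)) * \<epsilon>"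
    by (simp add: sum.distrib)
  also have "(\<Sum>x\<in>cube n. \<Sum>i\<in>{1..n}. \<bar>h i x\<bar>)
      \<le> 200000 * (1 + ln N) * (\<Sum>x\<in>cube n. L2_set (\<lambda>i. V' i x) {1..n})"
    by (rule duality_bound[OF anti h1 f1 div gain])
  also have "(\<Sum>x\<in>cube n. L2_set (\<lambda>i. V' i x) {1..n}) = (\<Sum>x\<in>cube n. L2_set (V x) {1..n})"
    by (intro sum.cong refl) (simp add: V'_def)
  also have "1 + ln N = ln (exp 1 * real n)"
    unfolding N using n by (simp add: ln_mult)
  finally have le: "(\<Sum>x\<in>cube n. sqrt (\<Sum>i\<in>{1..n}. (w x i)\<^sup>2))
      \<le> 200000 * ln (exp 1 * real n) * (\<Sum>x\<in>cube n. L2_set (V x) {1..n}) + real (card (cube n)) * \<epsilon>"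
    by simp
  have c0: "0 < real (card (cube n))"
    using finite_cube cube_nonempty by (simp add: card_gt_0_iff)
  have "talagrand_frac n f \<le> talagrand_coloring n f \<theta>"
    unfolding talagrand_frac_def using \<theta>
    by (intro cINF_lower talagrand_bdd_below) (auto simp: Pi_iff)
  also have "\<dots> = (\<Sum>x\<in>cube n. sqrt (\<Sum>i\<in>{1..n}. (w x i)\<^sup>2)) / real (card (cube n))"
    by (simp add: talagrand_coloring_share[OF f] w_def)
  also have "\<dots> \<le> (200000 * ln (exp 1 * real n) * (\<Sum>x\<in>cube n. L2_set (V x) {1..n})
      + real (card (cube n)) * \<epsilon>) / real (card (cube n))"
    using le by (rule divide_right_mono) simp
  also have "\<dots> = 200000 * ln (exp 1 * real n) * expect n (\<lambda>x. L2_set (V x) {1..n}) + \<epsilon>"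
    using c0 by (simp add: expect_sum add_divide_distrib)
  finally show ?thesis .
qed

theorem corollary3p5:
  "\<exists>C::real. \<forall>n\<ge>1. \<forall>f \<in> cube n \<rightarrow> {-1, 1}.
     talagrand_frac n f \<le> C * beckmann n f * ln (exp 1 * real n)"
proof (intro exI[of _ 200000] allI impI ballI)
  fix n :: nat and f assume n: "1 \<le> n" and f: "f \<in> cube n \<rightarrow> {-1, 1 :: real}"
  define c where "c = 200000 * ln (exp 1 * real n)"
  have c: "0 < c" using n by (simp add: c_def ln_mult add_pos_nonneg)
  have "talagrand_frac n f / c \<le> beckmann n f"
    unfolding beckmann_def
  proof (rule cINF_greatest[OF beckmann_fields_nonempty])
    fix V assume V: "V \<in> beckmann_fields n f"
    have "talagrand_frac n f \<le> c * expect n (\<lambda>x. L2_set (V x) {1..n})"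
    proof (rule field_le_epsilon)
      fix \<epsilon> :: real assume "0 < \<epsilon>"
      then show "talagrand_frac n f \<le> c * expect n (\<lambda>x. L2_set (V x) {1..n}) + \<epsilon>"
        unfolding c_def by (rule talagrand_le_field[OF n f V])
    qed
    then show "talagrand_frac n f / c \<le> expect n (\<lambda>x. L2_set (V x) {1..n})"
      using c by (simp add: pos_divide_le_eq mult.commute)
  qed
  then show "talagrand_frac n f \<le> 200000 * beckmann n f * ln (exp 1 * real n)"
    using c by (simp add: c_def pos_divide_le_eq mult_ac)
qed

end
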